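(* Given a connected labelled graph $\Gamma$, there exists an admissible map $\pi:\overline\Gamma\to\Gamma$ such that $\overline\Gamma$ is connected and contains no proper plateau. Every GBS group has a finite index subgroup represented by a labelled graph with no proper plateau.
   Context: A labelled graph is a finite graph $\Gamma$ (loops and multiple edges allowed, not necessarily connected) in which each oriented edge $e$ carries a label $\lambda_e$, a nonzero integer (possibly negative). We denote by $o(e)$ the origin of $e$ and by $\tilde e$ the edge $e$ with the opposite orientation; $\lambda_e$ is called the label of $e$ near $o(e)$. A connected labelled graph defines a graph of groups in which all vertex and edge groups are $\mathbb{Z}$ and the inclusion from the edge group $G_e$ (with $G_e=G_{\tilde e}$) into the vertex group $G_{o(e)}$ is multiplication by $\lambda_e$. The fundamental group of this graph of groups is the group represented by $\Gamma$. A generalized Baumslag-Solitar (GBS) group is a group represented by some (finite, connected) labelled graph. A morphism between graphs is a map sending each vertex to a vertex and each edge to an edge (compatibly with origins and with orientation reversal). An admissible map from $\overline\Gamma$ to $\Gamma$ is a pair $(\pi,m)$ where $\pi:\overline\Gamma\to\Gamma$ is a morphism and $m$ assigns a positive integer multiplicity to each vertex and each non-oriented edge of $\overline\Gamma$, such that: for any oriented edge $e$ of $\Gamma$ with origin $v$ and any vertex $x\in\pi^{-1}(v)$, setting $k_{x,e}=\gcd(m_x,\lambda_e)>0$, there are exactly $k_{x,e}$ oriented edges of $\overline\Gamma$ with origin $x$ mapping to $e$; they each have multiplicity $m_x/k_{x,e}$, and their label near $x$ is $\lambda_e/k_{x,e}$. One usually writes just $\pi$. Let $p$ be a prime. A non-empty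 connected subgraph $P$ of a labelled graph is a $p$-plateau if for every oriented edge $e$ of the graph with $o(e)\in P$: the label $\lambda_e$ is divisible by $p$ if and only if $e$ is not contained in $P$. A plateau is a subgraph that is a $p$-plateau for some prime $p$; it is proper if it is not the whole graph. *)

theory Defs
  imports
    "Graph_Theory.Digraph_Component"
    "Graph_Theory.Bidirected_Digraph"
    "HOL-Algebra.Elementary_Groups"
    "HOL-Computational_Algebra.Primes"
begin

section \<open>Fundamental groups of graphs of groups\<close>

text \<open>
  Graphs are understood in the sense of Serre: every geometric edge consists of two distinct
  oriented arcs \<open>e\<close> and \<open>arev e\<close>, exchanged by the fixed-point-free involution \<open>arev\<close> (loops and
  multiple edges are allowed). The origin of \<open>e\<close> is \<open>tail G e\<close>. The injection
  \<open>incl e\<close> maps \<open>edge_grp e\<close> into the vertex group at the origin of \<open>e\<close>.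
\<close>

locale graph_of_groups = bidirected_digraph G arev
  for G :: "('v, 'e) pre_digraph" and arev :: "'e \<Rightarrow> 'e" +
  fixes vertex_grp :: "'v \<Rightarrow> 'g monoid"
    and edge_grp :: "'e \<Rightarrow> 'c monoid"
    and incl :: "'e \<Rightarrow> 'c \<Rightarrow> 'g"
  assumes vertex_grp: "v \<in> verts G \<Longrightarrow> group (vertex_grp v)"
    and edge_grp: "e \<in> arcs G \<Longrightarrow> group (edge_grp e)"
    and edge_grp_arev: "e \<in> arcs G \<Longrightarrow> edge_grp (arev e) = edge_grp e"
    and incl: "e \<in> arcs G \<Longrightarrow> incl e \<in> mon (edge_grp e) (vertex_grp (tail G e))"

datatype ('v, 'e, 'g) letter = Elt 'v 'g | Stable 'e

context graph_of_groups
begin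

definition letters :: "('v, 'e, 'g) letter set" where
  "letters = {Elt v g | v g. v \<in> verts G \<and> g \<in> carrier (vertex_grp v)} \<union> Stable ` arcs G"

text \<open>
  Defining relations of Serre's group \<open>F\<close>, which is generated by the vertex groups and one stable
  letter per oriented arc: \<open>t\<^bsub>arev e\<^esub> = t\<^sub>e\<^sup>-\<^sup>1\<close> and
  \<open>t\<^sub>e \<cdot> incl (arev e) c \<cdot> t\<^sub>e\<^sup>-\<^sup>1 = incl e c\<close>. Since every letter has an inverse letter modulo
  these relations, no formal inverses are needed.
\<close>

inductive rewr :: "('v, 'e, 'g) letter list \<Rightarrow> ('v, 'e, 'g) letter list \<Rightarrow> bool" where
  mult: "\<lbrakk>v \<in> verts G; g \<in> carrier (vertex_grp v); h \<in> carrier (vertex_grp v);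
      xs \<in> lists letters; ys \<in> lists letters\<rbrakk>
    \<Longrightarrow> rewr (xs @ [Elt v g, Elt v h] @ ys) (xs @ [Elt v (g \<otimes>\<^bsub>vertex_grp v\<^esub> h)] @ ys)"
| one: "\<lbrakk>v \<in> verts G; xs \<in> lists letters; ys \<in> lists letters\<rbrakk>
    \<Longrightarrow> rewr (xs @ [Elt v \<one>\<^bsub>vertex_grp v\<^esub>] @ ys) (xs @ ys)"
| inverse: "\<lbrakk>e \<in> arcs G; xs \<in> lists letters; ys \<in> lists letters\<rbrakk>
    \<Longrightarrow> rewr (xs @ [Stable e, Stable (arev e)] @ ys) (xs @ ys)"
| conj: "\<lbrakk>e \<in> arcs G; c \<in> carrier (edge_grp e); xs \<in> lists letters; ys \<in> lists letters\<rbrakk>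
    \<Longrightarrow> rewr (xs @ [Stable e, Elt (head G e) (incl (arev e) c), Stable (arev e)] @ ys)
             (xs @ [Elt (tail G e) (incl e c)] @ ys)"

definition word_class :: "('v, 'e, 'g) letter list \<Rightarrow> ('v, 'e, 'g) letter list set" where
  "word_class w = {w'. equivclp rewr w w'}"

definition path_group :: "('v, 'e, 'g) letter list set monoid" where
  "path_group =
    \<lparr>carrier = word_class ` lists letters,
     monoid.mult = (\<lambda>A B. \<Union>a\<in>A. \<Union>b\<in>B. word_class (a @ b)),
     one = word_class []\<rparr>"

text \<open>
  Words \<open>g\<^sub>0 t\<^bsub>e\<^sub>1\<^esub> g\<^sub>1 \<dots> t\<^bsub>e\<^sub>n\<^esub> g\<^sub>n\<close> carried by an edge path \<open>e\<^sub>1 \<dots> e\<^sub>n\<close>, each \<open>g\<^sub>i\<close> lying in the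
  vertex group at the \<open>i\<close>-th vertex of the path. For convenience, any number of vertex group
  letters is allowed between consecutive stable letters, which does not change the set of
  elements represented.
\<close>

inductive path_word :: "'v \<Rightarrow> ('v, 'e, 'g) letter list \<Rightarrow> 'v \<Rightarrow> bool" where
  Nil: "v \<in> verts G \<Longrightarrow> path_word v [] v"
| Elt: "\<lbrakk>v \<in> verts G; g \<in> carrier (vertex_grp v); path_word v w u\<rbrakk>
    \<Longrightarrow> path_word v (Elt v g # w) u"
| Stable: "\<lbrakk>e \<in> arcs G; path_word (head G e) w u\<rbrakk>
    \<Longrightarrow> path_word (tail G e) (Stable e # w) u"

definition fundamental_group :: "'v \<Rightarrow> ('v, 'e, 'g) letter list set monoid" where
  "fundamental_group v = path_group\<lparr>carrier := {word_class w | w. path_word v w v}\<rparr>"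

end


section \<open>Labelled graphs\<close>

record ('v, 'e) lgraph =
  skeleton :: "('v, 'e) pre_digraph"
  opposite :: "'e \<Rightarrow> 'e"
  label :: "'e \<Rightarrow> int"

locale labelled_graph =
  fixes \<Gamma> :: "('v, 'e) lgraph"
  assumes fin: "fin_digraph (skeleton \<Gamma>)"
    and bidirected: "bidirected_digraph (skeleton \<Gamma>) (opposite \<Gamma>)"
    and label_nonzero: "e \<in> arcs (skeleton \<Gamma>) \<Longrightarrow> label \<Gamma> e \<noteq> 0"

definition connected_labelled_graph :: "('v, 'e) lgraph \<Rightarrow> bool" where
  "connected_labelled_graph \<Gamma> \<longleftrightarrow> labelled_graph \<Gamma> \<and> connected (skeleton \<Gamma>)"

lemma graph_of_groups_labelled_graph:
  assumes "labelled_graph \<Gamma>"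
  shows "graph_of_groups (skeleton \<Gamma>) (opposite \<Gamma>) (\<lambda>_. integer_group) (\<lambda>_. integer_group)
           (\<lambda>e c. label \<Gamma> e * c)"
proof -
  interpret labelled_graph \<Gamma> by fact
  interpret bidirected_digraph "skeleton \<Gamma>" "opposite \<Gamma>" by (fact bidirected)
  show ?thesis
    by (intro graph_of_groups.intro graph_of_groups_axioms.intro bidirected)
      (auto simp: mon_def hom_def inj_on_def distrib_left label_nonzero)
qed

definition labelled_graph_group ::
    "('v, 'e) lgraph \<Rightarrow> 'v \<Rightarrow> ('v, 'e, int) letter list set monoid" where
  "labelled_graph_group \<Gamma> =
    graph_of_groups.fundamental_group (skeleton \<Gamma>) (opposite \<Gamma>)
      (\<lambda>_. integer_group) (\<lambda>_. integer_group) (\<lambda>e c. label \<Gamma> e * c)"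

text \<open>
  For connected graphs the fundamental group does not depend on the base vertex up to isomorphism.
\<close>

definition represented_by :: "('g, 'b) monoid_scheme \<Rightarrow> ('v, 'e) lgraph \<Rightarrow> bool" where
  "represented_by A \<Gamma> \<longleftrightarrow>
    connected_labelled_graph \<Gamma> \<and>
    (\<exists>v \<in> verts (skeleton \<Gamma>). A \<cong> labelled_graph_group \<Gamma> v)"

text \<open>Every finite graph is isomorphic to one whose vertices and arcs are natural numbers.\<close>

definition GBS_group :: "('g, 'b) monoid_scheme \<Rightarrow> bool" where
  "GBS_group A \<longleftrightarrow> group A \<and> (\<exists>\<Gamma> :: (nat, nat) lgraph. represented_by A \<Gamma>)"


section \<open>Admissible maps\<close>

record ('v', 'e', 'v, 'e) map_with_mult =
  vmap :: "'v' \<Rightarrow> 'v"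
  emap :: "'e' \<Rightarrow> 'e"
  vmult :: "'v' \<Rightarrow> nat"
  emult :: "'e' \<Rightarrow> nat"

definition graph_morphism ::
    "('v', 'e') lgraph \<Rightarrow> ('v, 'e) lgraph \<Rightarrow> ('v' \<Rightarrow> 'v) \<Rightarrow> ('e' \<Rightarrow> 'e) \<Rightarrow> bool" where
  "graph_morphism \<Delta> \<Gamma> f g \<longleftrightarrow>
    f ` verts (skeleton \<Delta>) \<subseteq> verts (skeleton \<Gamma>) \<and>
    g ` arcs (skeleton \<Delta>) \<subseteq> arcs (skeleton \<Gamma>) \<and>
    (\<forall>e \<in> arcs (skeleton \<Delta>).
      f (tail (skeleton \<Delta>) e) = tail (skeleton \<Gamma>) (g e) \<and> g (opposite \<Delta> e) = opposite \<Gamma> (g e))"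

definition lifts ::
    "('v', 'e') lgraph \<Rightarrow> ('e' \<Rightarrow> 'e) \<Rightarrow> 'v' \<Rightarrow> 'e \<Rightarrow> 'e' set" where
  "lifts \<Delta> g x e = {e' \<in> arcs (skeleton \<Delta>). tail (skeleton \<Delta>) e' = x \<and> g e' = e}"

text \<open>
  Invariance of \<open>emult\<close> under reversal expresses that multiplicities are attached to non-oriented
  edges. The integer division is exact.
\<close>

definition admissible ::
    "('v', 'e') lgraph \<Rightarrow> ('v, 'e) lgraph \<Rightarrow> ('v', 'e', 'v, 'e) map_with_mult \<Rightarrow> bool" where
  "admissible \<Delta> \<Gamma> \<pi> \<longleftrightarrow>
    graph_morphism \<Delta> \<Gamma> (vmap \<pi>) (emap \<pi>) \<and>
    (\<forall>x \<in> verts (skeleton \<Delta>). vmult \<pi> x > 0) \<and>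
    (\<forall>e' \<in> arcs (skeleton \<Delta>). emult \<pi> e' > 0 \<and> emult \<pi> (opposite \<Delta> e') = emult \<pi> e') \<and>
    (\<forall>e \<in> arcs (skeleton \<Gamma>). \<forall>x \<in> verts (skeleton \<Delta>). vmap \<pi> x = tail (skeleton \<Gamma>) e \<longrightarrow>
      (let k = gcd (int (vmult \<pi> x)) (label \<Gamma> e) in
        int (card (lifts \<Delta> (emap \<pi>) x e)) = k \<and>
        (\<forall>e' \<in> lifts \<Delta> (emap \<pi>) x e.
          int (emult \<pi> e') = int (vmult \<pi> x) div k \<and>
          label \<Delta> e' = label \<Gamma> e div k)))"


section \<open>Plateaus\<close>

text \<open>The library's \<open>connected\<close> includes non-emptiness.\<close>

definition p_plateau :: "('v, 'e) lgraph \<Rightarrow> nat \<Rightarrow> ('v, 'e) pre_digraph \<Rightarrow> bool" where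
  "p_plateau \<Gamma> p P \<longleftrightarrow>
    subgraph P (skeleton \<Gamma>) \<and> opposite \<Gamma> ` arcs P \<subseteq> arcs P \<and> connected P \<and>
    (\<forall>e \<in> arcs (skeleton \<Gamma>). tail (skeleton \<Gamma>) e \<in> verts P \<longrightarrow>
      (int p dvd label \<Gamma> e \<longleftrightarrow> e \<notin> arcs P))"

definition plateau :: "('v, 'e) lgraph \<Rightarrow> ('v, 'e) pre_digraph \<Rightarrow> bool" where
  "plateau \<Gamma> P \<longleftrightarrow> (\<exists>p. prime p \<and> p_plateau \<Gamma> p P)"

definition proper_plateau :: "('v, 'e) lgraph \<Rightarrow> ('v, 'e) pre_digraph \<Rightarrow> bool" where
  "proper_plateau \<Gamma> P \<longleftrightarrow> plateau \<Gamma> P \<and> P \<noteq> skeleton \<Gamma>"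

end

theory Submission
  imports Defs
begin

text \<open>
  Give every vertex over \<open>v\<close> the same multiplicity \<open>N v\<close>. The labels of the covering graph then depend
  only on \<open>N\<close>, and the only constraint on \<open>N\<close> is that both ends of an edge assign it the same
  multiplicity. If the covering graph has a proper \<open>p\<close>-plateau, multiplying \<open>N\<close> by \<open>p\<close> on its projection
  preserves this constraint. A proper \<open>p\<close>-plateau also exhibits a vertex at which the \<open>p\<close>-part of \<open>N\<close>
  is smaller than that of some label; by connectedness this bounds \<open>N\<close>, so a maximal \<open>N\<close> works.

  An admissible map sends the generator at \<open>x\<close> to the \<open>m\<^sub>x\<close>-th power of the generator at its image,
  and a stable letter to a conjugate of a stable letter by powers of the vertex generators. Instead of
  using normal forms, injectivity is obtained by letting the group of \<open>\<Gamma>\<close> act on pairs consisting of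
  a point of the finite covering and an element of the group of \<open>\<Delta>\<close>, as in the representation
  induced from a subgroup; every word then equals the image of a word of \<open>\<Delta>\<close> times one of finitely many
  coset representatives.
\<close>

section \<open>Words in Serre's group\<close>

text \<open>The bound on \<open>N\<close> rests on two comparisons. Along an edge, the value at the
  head divides the value at the origin times a label, so with \<open>L\<close> the product of all
  labels there is one exponent \<open>K\<close> such that each value of a balanced \<open>N\<close>
  divides any other value times \<open>L ^ K\<close>. At an edge \<open>e\<close> where
  \<open>p\<close> divides the covering label, \<open>p\<close> does not divide the quotient of
  \<open>N (org e)\<close> by its gcd with the label of \<open>e\<close>, and \<open>p\<close> times
  this gcd divides \<open>L\<close>. Together they show that values dividing
  \<open>L ^ Suc K\<close> still do so after multiplication by \<open>p\<close>. It is essential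
  that \<open>K\<close> does not depend on \<open>N\<close>; otherwise a maximal \<open>N\<close>
  need not exist. On the group side, an admissible map prescribes only how many lifts an edge has at
  a vertex. The map of words and the action are therefore built on an arbitrary bijection between
  these lifts and residues.\<close>

context graph_of_groups
begin

fun src :: "('v, 'e, 'g) letter \<Rightarrow> 'v" where
  "src (Elt v g) = v"
| "src (Stable e) = tail G e"

fun tgt :: "('v, 'e, 'g) letter \<Rightarrow> 'v" where
  "tgt (Elt v g) = v"
| "tgt (Stable e) = head G e"

fun inv_letter :: "('v, 'e, 'g) letter \<Rightarrow> ('v, 'e, 'g) letter" where
  "inv_letter (Elt v g) = Elt v (inv\<^bsub>vertex_grp v\<^esub> g)"
| "inv_letter (Stable e) = Stable (arev e)"

definition inv_word :: "('v, 'e, 'g) letter list \<Rightarrow> ('v, 'e, 'g) letter list" where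
  "inv_word w = rev (map inv_letter w)"

lemma Elt_in_letters [simp]:
  "Elt v g \<in> letters \<longleftrightarrow> v \<in> verts G \<and> g \<in> carrier (vertex_grp v)"
  by (auto simp: letters_def)

lemma Stable_in_letters [simp]: "Stable e \<in> letters \<longleftrightarrow> e \<in> arcs G"
  by (auto simp: letters_def)

lemma incl_in_carrier [simp]:
  "e \<in> arcs G \<Longrightarrow> c \<in> carrier (edge_grp e) \<Longrightarrow> incl e c \<in> carrier (vertex_grp (tail G e))"
  using incl[of e] by (auto simp: mon_def hom_def)

lemma incl_arev_in_carrier [simp]:
  "e \<in> arcs G \<Longrightarrow> c \<in> carrier (edge_grp e) \<Longrightarrow> incl (arev e) c \<in> carrier (vertex_grp (head G e))"
  using incl_in_carrier[of "arev e" c] by (simp add: edge_grp_arev)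

lemma src_in_verts [simp]: "l \<in> letters \<Longrightarrow> src l \<in> verts G"
  by (cases l) auto

lemma tgt_in_verts [simp]: "l \<in> letters \<Longrightarrow> tgt l \<in> verts G"
  by (cases l) auto

lemma inv_letter_in_letters [simp]: "l \<in> letters \<Longrightarrow> inv_letter l \<in> letters"
  by (cases l) (auto simp: vertex_grp)

lemma src_inv_letter [simp]: "l \<in> letters \<Longrightarrow> src (inv_letter l) = tgt l"
  by (cases l) auto

lemma tgt_inv_letter [simp]: "l \<in> letters \<Longrightarrow> tgt (inv_letter l) = src l"
  by (cases l) auto

lemma inv_inv_letter [simp]: "l \<in> letters \<Longrightarrow> inv_letter (inv_letter l) = l"
  by (cases l) (auto simp: vertex_grp group.inv_inv)

lemma inv_word_in_lists [simp]: "w \<in> lists letters \<Longrightarrow> inv_word w \<in> lists letters"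
  by (auto simp: inv_word_def)

lemma inv_word_simps [simp]:
  "inv_word [] = []" "inv_word (l # w) = inv_word w @ [inv_letter l]"
  by (simp_all add: inv_word_def)

lemma inv_inv_word [simp]: "w \<in> lists letters \<Longrightarrow> inv_word (inv_word w) = w"
  by (induction w) (auto simp: inv_word_def)

lemma path_word_Cons:
  "path_word v (l # w) u \<longleftrightarrow> l \<in> letters \<and> src l = v \<and> path_word (tgt l) w u"
  by (cases l) (auto intro: path_word.intros elim: path_word.cases)

lemma path_word_Nil: "path_word v [] u \<longleftrightarrow> v = u \<and> v \<in> verts G"
  by (auto intro: path_word.intros elim: path_word.cases)

lemma path_word_verts: "path_word v w u \<Longrightarrow> v \<in> verts G \<and> u \<in> verts G"
  by (induction w arbitrary: v) (auto simp: path_word_Cons path_word_Nil)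

lemma path_word_append:
  "path_word v (w @ w') u \<longleftrightarrow> (\<exists>x. path_word v w x \<and> path_word x w' u)"
  by (induction w arbitrary: v) (auto simp: path_word_Cons path_word_Nil dest: path_word_verts)

lemma path_word_in_lists: "path_word v w u \<Longrightarrow> w \<in> lists letters"
  by (induction w arbitrary: v) (auto simp: path_word_Cons)

lemma path_word_inv: "path_word v w u \<Longrightarrow> path_word u (inv_word w) v"
  by (induction w arbitrary: v) (auto simp: path_word_Cons path_word_Nil path_word_append)

lemma path_word_exists:
  assumes "connected G" "u \<in> verts G" "v \<in> verts G"
  shows "\<exists>w. path_word u w v"
proof -
  have "u \<rightarrow>\<^sup>*\<^bsub>G\<^esub> v"
    using symmetric_connected_imp_strongly_connected[OF sym_arcs assms(1)] assms(2,3)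
    by (auto simp: strongly_connected_def)
  then show ?thesis
  proof (induction rule: converse_reachable_induct)
    case base
    then show ?case by (blast intro: path_word.Nil)
  next
    case (step x y)
    then obtain e w where "e \<in> arcs G" "tail G e = x" "head G e = y" "path_word y w v" by blast
    then have "path_word x (Stable e # w) v" by (simp add: path_word_Cons)
    then show ?case ..
  qed
qed

lemma rewr_in_lists: "rewr w w' \<Longrightarrow> w \<in> lists letters \<and> w' \<in> lists letters"
  by (induction rule: rewr.induct) (auto simp: vertex_grp group.is_monoid monoid.m_closed)

lemma rewr_context:
  assumes "rewr w w'" "xs \<in> lists letters" "ys \<in> lists letters"
  shows "rewr (xs @ w @ ys) (xs @ w' @ ys)"
  using assms
proof (cases rule: rewr.cases)
  case (mult v g h as bs)
  then show ?thesis using rewr.mult[of v g h "xs @ as" "bs @ ys"] assms by simp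
next
  case (one v as bs)
  then show ?thesis using rewr.one[of v "xs @ as" "bs @ ys"] assms by simp
next
  case (inverse e as bs)
  then show ?thesis using rewr.inverse[of e "xs @ as" "bs @ ys"] assms by simp
next
  case (conj e c as bs)
  then show ?thesis using rewr.conj[of e c "xs @ as" "bs @ ys"] assms by simp
qed

lemma word_class_eq_iff: "word_class w = word_class w' \<longleftrightarrow> equivclp rewr w w'"
  unfolding word_class_def by (auto intro: equivclp_sym equivclp_trans)

lemma mem_word_class: "w' \<in> word_class w \<longleftrightarrow> word_class w' = word_class w"
  unfolding word_class_eq_iff by (auto simp: word_class_def intro: equivclp_sym)

lemma word_class_self [simp]: "w \<in> word_class w"
  by (simp add: mem_word_class)

lemma word_class_rewr: "rewr w w' \<Longrightarrow> word_class w = word_class w'"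
  by (auto simp: word_class_eq_iff)

text \<open>The way to define maps out of the group: invariance need only be checked on single
  rewriting steps. Membership is part of the conclusion because \<open>word_class\<close> also makes
  sense for lists outside \<open>lists letters\<close>.\<close>

lemma word_class_induct [consumes 2, case_names rewr]:
  assumes "word_class w = word_class w'" "w \<in> lists letters"
    and "\<And>a b. rewr a b \<Longrightarrow> f a = f b"
  shows "w' \<in> lists letters \<and> f w = f w'"
proof -
  have "equivclp rewr w w'" using assms(1) by (simp add: word_class_eq_iff)
  then show ?thesis
  proof (induction rule: equivclp_induct)
    case base
    then show ?case using assms(2) by simp
  next
    case (step y z)
    then show ?case using rewr_in_lists[of y z] rewr_in_lists[of z y] assms(3)[of y z] assms(3)[of z y]
      by auto
  qed
qed

lemma word_class_in_lists:
  "word_class w = word_class w' \<Longrightarrow> w \<in> lists letters \<Longrightarrow> w' \<in> lists letters"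
  using word_class_induct[of w w' "\<lambda>_. ()"] by simp

lemma word_class_append_cong:
  assumes "word_class a = word_class a'" "word_class b = word_class b'"
    and "a \<in> lists letters" "b \<in> lists letters"
  shows "word_class (a @ b) = word_class (a' @ b')"
proof -
  have "word_class (a @ b) = word_class (a' @ b)"
  proof -
    have "equivclp rewr a a'" using assms(1) by (simp add: word_class_eq_iff)
    then show ?thesis
    proof (induction rule: equivclp_induct)
      case (step y z)
      have "word_class (y @ b) = word_class (z @ b)"
        using step(2) rewr_context[of y z "[]" b] rewr_context[of z y "[]" b] assms(4)
        by (auto dest: word_class_rewr)
      with step show ?case by simp
    qed simp
  qed
  moreover have "word_class (a' @ b) = word_class (a' @ b')"
  proof -
    have a': "a' \<in> lists letters" using word_class_in_lists assms by blast
    have "equivclp rewr b b'" using assms(2) by (simp add: word_class_eq_iff)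
    then show ?thesis
    proof (induction rule: equivclp_induct)
      case (step y z)
      have "word_class (a' @ y) = word_class (a' @ z)"
        using step(2) rewr_context[of y z a' "[]"] rewr_context[of z y a' "[]"] a'
        by (auto dest: word_class_rewr)
      with step show ?case by simp
    qed simp
  qed
  ultimately show ?thesis by simp
qed

section \<open>Group structure on word classes\<close>

lemma carrier_path_group: "carrier path_group = word_class ` lists letters"
  by (simp add: path_group_def)

lemma one_path_group [simp]: "\<one>\<^bsub>path_group\<^esub> = word_class []"
  by (simp add: path_group_def)

lemma word_class_in_path_group [simp]: "w \<in> lists letters \<Longrightarrow> word_class w \<in> carrier path_group"
  by (simp add: carrier_path_group)

lemma mult_path_group [simp]:
  assumes "a \<in> lists letters" "b \<in> lists letters"
  shows "word_class a \<otimes>\<^bsub>path_group\<^esub> word_class b = word_class (a @ b)"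
proof -
  have "word_class (a' @ b') = word_class (a @ b)"
    if "a' \<in> word_class a" "b' \<in> word_class b" for a' b'
    using word_class_append_cong[of a a' b b'] assms that by (simp add: mem_word_class)
  then have "(\<Union>a'\<in>word_class a. \<Union>b'\<in>word_class b. word_class (a' @ b')) = word_class (a @ b)"
    using word_class_self[of a] word_class_self[of b] by blast
  then show ?thesis by (simp add: path_group_def)
qed

lemma word_class_inv_letter:
  assumes "l \<in> letters"
  shows "word_class [l, inv_letter l] = word_class []"
proof (cases l)
  case (Elt v g)
  then have vg: "v \<in> verts G" "g \<in> carrier (vertex_grp v)" using assms by auto
  interpret vg: group "vertex_grp v" using vg(1) by (rule vertex_grp)
  have "rewr [Elt v g, Elt v (inv\<^bsub>vertex_grp v\<^esub> g)] [Elt v \<one>\<^bsub>vertex_grp v\<^esub>]"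
    using rewr.mult[of v g "inv\<^bsub>vertex_grp v\<^esub> g" "[]" "[]"] vg by simp
  moreover have "rewr [Elt v \<one>\<^bsub>vertex_grp v\<^esub>] []"
    using rewr.one[of v "[]" "[]"] vg by simp
  ultimately show ?thesis using Elt word_class_rewr by simp
next
  case (Stable e)
  then show ?thesis using assms rewr.inverse[of e "[]" "[]"] word_class_rewr by simp
qed

lemma word_class_inv_word_right:
  "w \<in> lists letters \<Longrightarrow> word_class (w @ inv_word w) = word_class []"
proof (induction w)
  case (Cons l w)
  then have "word_class ([l] @ (w @ inv_word w) @ [inv_letter l]) = word_class ([l] @ [] @ [inv_letter l])"
    by (intro word_class_append_cong) auto
  with Cons show ?case by (simp add: word_class_inv_letter)
qed simp

lemma word_class_inv_word_left:
  "w \<in> lists letters \<Longrightarrow> word_class (inv_word w @ w) = word_class []"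
  using word_class_inv_word_right[of "inv_word w"] by simp

lemma group_path_group: "group path_group"
proof (rule groupI)
  fix x y assume "x \<in> carrier path_group" "y \<in> carrier path_group"
  then show "x \<otimes>\<^bsub>path_group\<^esub> y \<in> carrier path_group"
    unfolding carrier_path_group
    by (elim imageE) (metis append_in_lists_conv imageI mult_path_group)
next
  fix x y z assume "x \<in> carrier path_group" "y \<in> carrier path_group" "z \<in> carrier path_group"
  then obtain a b c where "a \<in> lists letters" "b \<in> lists letters" "c \<in> lists letters"
    "x = word_class a" "y = word_class b" "z = word_class c"
    unfolding carrier_path_group by (elim imageE) (rule that)
  then show "x \<otimes>\<^bsub>path_group\<^esub> y \<otimes>\<^bsub>path_group\<^esub> z = x \<otimes>\<^bsub>path_group\<^esub> (y \<otimes>\<^bsub>path_group\<^esub> z)"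
    by simp
next
  fix x assume "x \<in> carrier path_group"
  then obtain w where w: "w \<in> lists letters" "x = word_class w"
    unfolding carrier_path_group by (elim imageE) (rule that)
  show "\<exists>y\<in>carrier path_group. y \<otimes>\<^bsub>path_group\<^esub> x = \<one>\<^bsub>path_group\<^esub>"
    using w word_class_inv_word_left[of w]
    by (intro bexI[of _ "word_class (inv_word w)"]) auto
next
  show "\<one>\<^bsub>path_group\<^esub> \<in> carrier path_group" by simp
next
  fix x assume "x \<in> carrier path_group"
  then show "\<one>\<^bsub>path_group\<^esub> \<otimes>\<^bsub>path_group\<^esub> x = x"
    unfolding carrier_path_group by (elim imageE) simp
qed

lemma inv_path_group:
  assumes "w \<in> lists letters"
  shows "inv\<^bsub>path_group\<^esub> (word_class w) = word_class (inv_word w)"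
proof -
  interpret group path_group by (rule group_path_group)
  show ?thesis
    using assms word_class_inv_word_left[of w]
    by (intro inv_equality) auto
qed

lemma subgroup_fundamental_group:
  assumes "v \<in> verts G"
  shows "subgroup {word_class w | w. path_word v w v} path_group"
proof (rule group.subgroupI[OF group_path_group])
  show "{word_class w | w. path_word v w v} \<subseteq> carrier path_group"
    using path_word_in_lists word_class_in_path_group by blast
  show "{word_class w | w. path_word v w v} \<noteq> {}"
    using assms path_word.Nil by blast
next
  fix a assume "a \<in> {word_class w | w. path_word v w v}"
  then show "inv\<^bsub>path_group\<^esub> a \<in> {word_class w | w. path_word v w v}"
    by (auto simp: inv_path_group path_word_in_lists intro: path_word_inv)
next
  fix a b assume "a \<in> {word_class w | w. path_word v w v}" "b \<in> {word_class w | w. path_word v w v}"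
  then obtain w w' where "a = word_class w" "path_word v w v" "b = word_class w'" "path_word v w' v"
    by auto
  then show "a \<otimes>\<^bsub>path_group\<^esub> b \<in> {word_class w | w. path_word v w v}"
    by (auto simp: path_word_in_lists path_word_append
        intro!: exI[of _ "w @ w'"])
qed

lemma group_fundamental_group: "v \<in> verts G \<Longrightarrow> group (fundamental_group v)"
  unfolding fundamental_group_def
  by (intro subgroup.subgroup_is_group subgroup_fundamental_group group_path_group)

lemma carrier_fundamental_group:
  "carrier (fundamental_group v) = {word_class w | w. path_word v w v}"
  by (simp add: fundamental_group_def)

lemma mult_fundamental_group: "(\<otimes>\<^bsub>fundamental_group v\<^esub>) = (\<otimes>\<^bsub>path_group\<^esub>)"
  by (simp add: fundamental_group_def)

end

text \<open>
  Right actions of the fundamental groupoid. The word relation of \<open>path_group\<close> passes through words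
  that are not edge paths; conjugating by fixed paths from a base vertex extends the action on the
  fibre over the base vertex to all words, so that it is compatible with that relation.
\<close>

locale groupoid_action = graph_of_groups G arev vertex_grp edge_grp incl
  for G :: "('v, 'e) pre_digraph" and arev :: "'e \<Rightarrow> 'e" and vertex_grp :: "'v \<Rightarrow> 'g monoid"
    and edge_grp :: "'e \<Rightarrow> 'c monoid" and incl :: "'e \<Rightarrow> 'c \<Rightarrow> 'g" +
  fixes fibre :: "'v \<Rightarrow> 's set" and act :: "('v, 'e, 'g) letter \<Rightarrow> 's \<Rightarrow> 's"
  assumes act_closed: "l \<in> letters \<Longrightarrow> s \<in> fibre (src l) \<Longrightarrow> act l s \<in> fibre (tgt l)"
    and act_mult: "\<lbrakk>v \<in> verts G; g \<in> carrier (vertex_grp v); h \<in> carrier (vertex_grp v); s \<in> fibre v\<rbrakk>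
      \<Longrightarrow> act (Elt v h) (act (Elt v g) s) = act (Elt v (g \<otimes>\<^bsub>vertex_grp v\<^esub> h)) s"
    and act_one: "v \<in> verts G \<Longrightarrow> s \<in> fibre v \<Longrightarrow> act (Elt v \<one>\<^bsub>vertex_grp v\<^esub>) s = s"
    and act_inverse: "e \<in> arcs G \<Longrightarrow> s \<in> fibre (tail G e) \<Longrightarrow>
      act (Stable (arev e)) (act (Stable e) s) = s"
    and act_conj: "\<lbrakk>e \<in> arcs G; c \<in> carrier (edge_grp e); s \<in> fibre (tail G e)\<rbrakk> \<Longrightarrow>
      act (Stable (arev e)) (act (Elt (head G e) (incl (arev e) c)) (act (Stable e) s)) =
      act (Elt (tail G e) (incl e c)) s"
begin

abbreviation act_word :: "('v, 'e, 'g) letter list \<Rightarrow> 's \<Rightarrow> 's" where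
  "act_word \<equiv> fold act"

lemma act_word_closed: "path_word v w u \<Longrightarrow> s \<in> fibre v \<Longrightarrow> act_word w s \<in> fibre u"
  by (induction w arbitrary: v s) (auto simp: path_word_Cons path_word_Nil intro: act_closed)

lemma act_inv_letter:
  assumes "l \<in> letters" "s \<in> fibre (src l)"
  shows "act (inv_letter l) (act l s) = s"
proof (cases l)
  case (Elt v g)
  with assms interpret group "vertex_grp v" by (auto intro: vertex_grp)
  show ?thesis using Elt assms by (simp add: act_mult act_one)
next
  case (Stable e)
  then show ?thesis using assms act_inverse by simp
qed

lemma act_inv_word: "path_word v w u \<Longrightarrow> s \<in> fibre v \<Longrightarrow> act_word (inv_word w) (act_word w s) = s"
  by (induction w arbitrary: v s)
    (auto simp: path_word_Cons path_word_Nil act_inv_letter act_closed)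

lemma act_word_inv: "path_word v w u \<Longrightarrow> s \<in> fibre u \<Longrightarrow> act_word w (act_word (inv_word w) s) = s"
  using act_inv_word[OF path_word_inv, of v w u s] by (simp add: path_word_in_lists)

proposition act_word_eq:
  assumes "connected G" and w: "path_word v w v" and w': "path_word v w' v"
    and eq: "word_class w = word_class w'" and s: "s \<in> fibre v"
  shows "act_word w s = act_word w' s"
proof -
  have v: "v \<in> verts G" using w path_word_verts by blast
  then have "\<exists>p. \<forall>u\<in>verts G. path_word v (p u) u"
    using path_word_exists[OF assms(1) v] by metis
  then obtain p where p: "\<And>u. u \<in> verts G \<Longrightarrow> path_word v (p u) u" by blast
  define ext where "ext l t = act_word (inv_word (p (tgt l))) (act l (act_word (p (src l)) t))" for l t
  have ext_closed: "ext l t \<in> fibre v" if "l \<in> letters" "t \<in> fibre v" for l t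
    unfolding ext_def using that
    by (intro act_word_closed[OF path_word_inv[OF p]] act_closed act_word_closed[OF p]) auto
  have fold_ext_closed: "fold ext u t \<in> fibre v" if "u \<in> lists letters" "t \<in> fibre v" for u t
    using that by (induction u arbitrary: t) (auto intro: ext_closed)
  \<comment> \<open>The connecting paths of consecutive letters cancel, so that a genuine path acts
    as itself, up to \<open>p x\<close> at the start and \<open>inv_word (p y)\<close> at the
    end.\<close>
  have fold_ext: "fold ext u t = act_word (inv_word (p y)) (act_word u (act_word (p x) t))"
    if "path_word x u y" "t \<in> fibre v" for x u y t
    using that
  proof (induction u arbitrary: x t)
    case Nil
    then show ?case using act_inv_word[OF p] by (auto simp: path_word_Nil)
  next
    case (Cons l u)
    then have l: "l \<in> letters" "src l = x" and u: "path_word (tgt l) u y"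
      by (auto simp: path_word_Cons)
    have "act l (act_word (p x) t) \<in> fibre (tgt l)"
      using l Cons.prems by (metis act_closed act_word_closed p src_in_verts)
    then have "act_word (p (tgt l)) (ext l t) = act l (act_word (p x) t)"
      unfolding ext_def using l by (simp add: act_word_inv[OF p])
    then show ?case using Cons.IH[OF u ext_closed[OF l(1) Cons.prems(2)]] by simp
  qed
  \<comment> \<open>Each defining relation replaces a path by one with the same ends and the same
    action; the surrounding \<open>xs\<close> and \<open>ys\<close> need not be paths.\<close>
  have local: "fold ext (xs @ a @ ys) t = fold ext (xs @ b @ ys) t"
    if "path_word x a y" "path_word x b y" "xs \<in> lists letters" "t \<in> fibre v"
      "\<And>r. r \<in> fibre x \<Longrightarrow> act_word a r = act_word b r" for xs ys a b x y t
  proof -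
    have t': "fold ext xs t \<in> fibre v" using fold_ext_closed that by blast
    have "act_word (p x) (fold ext xs t) \<in> fibre x"
      using act_word_closed[OF p t'] path_word_verts that(1) by blast
    then have "fold ext a (fold ext xs t) = fold ext b (fold ext xs t)"
      using that by (simp add: fold_ext[OF that(1) t'] fold_ext[OF that(2) t'])
    then show ?thesis by simp
  qed
  have rewr_inv: "fold ext a t = fold ext b t" if ab: "rewr a b" and t: "t \<in> fibre v" for a b t
    using ab
  proof (cases rule: rewr.cases)
    case (mult u g h xs ys)
    interpret group "vertex_grp u" using mult by (intro vertex_grp)
    show ?thesis unfolding mult
      using mult t by (intro local[where x = u and y = u]) (auto simp: path_word_Cons path_word_Nil act_mult)
  next
    case (one u xs ys)
    interpret group "vertex_grp u" using one by (intro vertex_grp)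
    show ?thesis
      using one t local[where x = u and y = u and a = "[Elt u \<one>\<^bsub>vertex_grp u\<^esub>]" and b = "[]"]
      by (auto simp: path_word_Cons path_word_Nil act_one)
  next
    case (inverse e xs ys)
    then show ?thesis
      using t local[where x = "tail G e" and y = "tail G e" and b = "[]"
          and a = "[Stable e, Stable (arev e)]"]
      by (auto simp: path_word_Cons path_word_Nil act_inverse)
  next
    case (conj e c xs ys)
    show ?thesis unfolding conj
      using conj t by (intro local[where x = "tail G e" and y = "tail G e"])
        (auto simp: path_word_Cons path_word_Nil act_conj)
  qed
  \<comment> \<open>The relations are respected only on \<open>fibre v\<close>. Extension by the
    identity elsewhere turns this into the equality of functions that
    \<open>word_class_induct\<close> asks for.\<close>
  have fold_eq: "(\<lambda>t. if t \<in> fibre v then fold ext w t else t) =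
      (\<lambda>t. if t \<in> fibre v then fold ext w' t else t)"
    using word_class_induct[OF eq path_word_in_lists[OF w],
        of "\<lambda>w t. if t \<in> fibre v then fold ext w t else t"] rewr_inv by fastforce
  \<comment> \<open>\<open>p v\<close> need not be the empty path, so the argument starts at the
    point that \<open>p v\<close> carries to \<open>s\<close>.\<close>
  define t where "t = act_word (inv_word (p v)) s"
  have t: "t \<in> fibre v" "act_word (p v) t = s"
    unfolding t_def using s v act_word_closed[OF path_word_inv[OF p]] act_word_inv[OF p] by auto
  have "act_word (inv_word (p v)) (act_word w s) = act_word (inv_word (p v)) (act_word w' s)"
    using fun_cong[OF fold_eq, of t] t fold_ext[OF w t(1)] fold_ext[OF w' t(1)] by simp
  then show ?thesis
    using act_word_inv[OF p[OF v]] act_word_closed[OF w s] act_word_closed[OF w' s] by metis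
qed

end

section \<open>The monomorphism induced by an admissible map\<close>

sublocale labelled_graph \<subseteq> graph_of_groups "skeleton \<Gamma>" "opposite \<Gamma>" "\<lambda>_. integer_group"
    "\<lambda>_. integer_group" "\<lambda>e c. label \<Gamma> e * c"
  by (rule graph_of_groups_labelled_graph) unfold_locales

context labelled_graph
begin

lemma word_class_Elt_add:
  "v \<in> verts (skeleton \<Gamma>) \<Longrightarrow> word_class [Elt v a, Elt v b] = word_class [Elt v (a + b)]"
  using rewr.mult[of v a b "[]" "[]"] word_class_rewr by fastforce

lemma word_class_Elt_zero: "v \<in> verts (skeleton \<Gamma>) \<Longrightarrow> word_class [Elt v 0] = word_class []"
  using rewr.one[of v "[]" "[]"] word_class_rewr by fastforce

lemma word_class_cong:
  assumes "word_class a = word_class b" "xs \<in> lists letters" "a \<in> lists letters" "ys \<in> lists letters"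
  shows "word_class (xs @ a @ ys) = word_class (xs @ b @ ys)"
  using assms by (intro word_class_append_cong) auto

lemma word_class_Cons:
  "l \<in> letters \<Longrightarrow> w \<in> lists letters \<Longrightarrow> word_class (l # w) = word_class [l] \<otimes>\<^bsub>path_group\<^esub> word_class w"
  by simp

text \<open>The conjugation relation multiplied on the right by the stable letter; this form moves
  powers across an edge.\<close>

lemma word_class_slide:
  assumes e: "e \<in> arcs (skeleton \<Gamma>)"
  shows "word_class [Elt (tail (skeleton \<Gamma>) e) (label \<Gamma> e * c), Stable e] =
    word_class [Stable e, Elt (head (skeleton \<Gamma>) e) (label \<Gamma> (opposite \<Gamma> e) * c)]"
proof -
  let ?a = "Elt (head (skeleton \<Gamma>) e) (label \<Gamma> (opposite \<Gamma> e) * c)"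
  have "rewr ([] @ [Stable e, ?a, Stable (opposite \<Gamma> e)] @ [Stable e])
      ([] @ [Elt (tail (skeleton \<Gamma>) e) (label \<Gamma> e * c)] @ [Stable e])"
    using e by (intro rewr.conj) auto
  moreover have "rewr ([Stable e, ?a] @ [Stable (opposite \<Gamma> e), Stable (opposite \<Gamma> (opposite \<Gamma> e))] @ [])
      ([Stable e, ?a] @ [])"
    using e by (intro rewr.inverse) auto
  ultimately show ?thesis by (auto dest: word_class_rewr)
qed

end

locale admissible_map = base: labelled_graph \<Gamma> + total: labelled_graph \<Delta>
  for \<Gamma> :: "('v, 'e) lgraph" and \<Delta> :: "('a, 'b) lgraph" +
  fixes \<pi> :: "('a, 'b, 'v, 'e) map_with_mult"
  assumes admissible: "admissible \<Delta> \<Gamma> \<pi>"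
begin

abbreviation VB :: "'v set" where "VB \<equiv> verts (skeleton \<Gamma>)"
abbreviation EB :: "'e set" where "EB \<equiv> arcs (skeleton \<Gamma>)"
abbreviation VT :: "'a set" where "VT \<equiv> verts (skeleton \<Delta>)"
abbreviation ET :: "'b set" where "ET \<equiv> arcs (skeleton \<Delta>)"
abbreviation tlB :: "'e \<Rightarrow> 'v" where "tlB \<equiv> tail (skeleton \<Gamma>)"
abbreviation hdB :: "'e \<Rightarrow> 'v" where "hdB \<equiv> head (skeleton \<Gamma>)"
abbreviation tlT :: "'b \<Rightarrow> 'a" where "tlT \<equiv> tail (skeleton \<Delta>)"
abbreviation hdT :: "'b \<Rightarrow> 'a" where "hdT \<equiv> head (skeleton \<Delta>)"

section \<open>Lifts of edges and residues of exponents\<close>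

definition m :: "'a \<Rightarrow> int" where "m x = int (vmult \<pi> x)"

definition k :: "'a \<Rightarrow> 'e \<Rightarrow> int" where "k x e = gcd (m x) (label \<Gamma> e)"

abbreviation lifts_at :: "'a \<Rightarrow> 'e \<Rightarrow> 'b set" where "lifts_at \<equiv> lifts \<Delta> (emap \<pi>)"

lemma vmap_in_verts [simp]: "x \<in> VT \<Longrightarrow> vmap \<pi> x \<in> VB"
  using admissible by (auto simp: admissible_def graph_morphism_def)

lemma emap_in_arcs [simp]: "f \<in> ET \<Longrightarrow> emap \<pi> f \<in> EB"
  using admissible by (auto simp: admissible_def graph_morphism_def)

lemma vmap_tail [simp]: "f \<in> ET \<Longrightarrow> vmap \<pi> (tlT f) = tlB (emap \<pi> f)"
  using admissible by (auto simp: admissible_def graph_morphism_def)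

lemma emap_opposite [simp]: "f \<in> ET \<Longrightarrow> emap \<pi> (opposite \<Delta> f) = opposite \<Gamma> (emap \<pi> f)"
  using admissible by (auto simp: admissible_def graph_morphism_def)

lemma vmap_head [simp]: "f \<in> ET \<Longrightarrow> vmap \<pi> (hdT f) = hdB (emap \<pi> f)"
  using vmap_tail[of "opposite \<Delta> f"] by simp

lemma m_pos: "x \<in> VT \<Longrightarrow> 0 < m x"
  using admissible by (auto simp: admissible_def m_def)

lemma emult_opposite: "f \<in> ET \<Longrightarrow> emult \<pi> (opposite \<Delta> f) = emult \<pi> f"
  using admissible by (auto simp: admissible_def)

lemma emult_pos: "f \<in> ET \<Longrightarrow> 0 < emult \<pi> f"
  using admissible by (auto simp: admissible_def)

lemma k_pos: "x \<in> VT \<Longrightarrow> 0 < k x e"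
  using m_pos[of x] by (simp add: k_def)

lemma admissible_lifts:
  assumes "e \<in> EB" "x \<in> VT" "vmap \<pi> x = tlB e"
  shows "int (card (lifts_at x e)) = k x e"
    and "f \<in> lifts_at x e \<Longrightarrow> int (emult \<pi> f) * k x e = m x"
    and "f \<in> lifts_at x e \<Longrightarrow> label \<Delta> f * k x e = label \<Gamma> e"
  using admissible assms unfolding admissible_def Let_def k_def m_def by auto

lemma lifts_at_self: "f \<in> ET \<Longrightarrow> f \<in> lifts_at (tlT f) (emap \<pi> f)"
  by (simp add: lifts_def)

text \<open>Multiplicity and label at the tail are divided by the same \<open>k\<close>. In terms of
  groups, the inclusions of edge groups commute with the multiplications by \<open>emult\<close> and
  \<open>m\<close>, which is why the map of words respects the edge relations.\<close>

lemma label_emult: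
  assumes "f \<in> ET"
  shows "label \<Gamma> (emap \<pi> f) * int (emult \<pi> f) = m (tlT f) * label \<Delta> f"
proof -
  have *: "int (emult \<pi> f) * k (tlT f) (emap \<pi> f) = m (tlT f)"
    "label \<Delta> f * k (tlT f) (emap \<pi> f) = label \<Gamma> (emap \<pi> f)"
    using assms lifts_at_self[OF assms] by (auto intro!: admissible_lifts(2,3))
  show ?thesis unfolding *[symmetric] by (simp add: mult_ac)
qed

lemma label_emult_opposite:
  assumes "f \<in> ET"
  shows "label \<Gamma> (opposite \<Gamma> (emap \<pi> f)) * int (emult \<pi> f) = m (hdT f) * label \<Delta> (opposite \<Delta> f)"
  using label_emult[of "opposite \<Delta> f"] assms by (simp add: emult_opposite)

text \<open>
  The lifts of \<open>e\<close> at \<open>x\<close> correspond to the orbits of translation by \<open>label \<Gamma> e\<close> on the integers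
  modulo \<open>m x\<close>; \<open>pos f\<close> is the residue modulo \<open>k x e\<close> which describes the orbit of the lift \<open>f\<close>.
\<close>

definition pos :: "'b \<Rightarrow> int" where
  "pos f = (SOME h. bij_betw h (lifts_at (tlT f) (emap \<pi> f)) {0..<k (tlT f) (emap \<pi> f)}) f"

text \<open>This is where the prescribed number of lifts enters.\<close>

lemma bij_betw_pos:
  assumes "e \<in> EB" "x \<in> VT" "vmap \<pi> x = tlB e"
  shows "bij_betw pos (lifts_at x e) {0..<k x e}"
proof -
  define h where "h = (SOME h. bij_betw h (lifts_at x e) {0..<k x e})"
  interpret fin_digraph "skeleton \<Delta>" by (rule total.fin)
  have "finite (lifts_at x e)" by (simp add: lifts_def)
  moreover have "card (lifts_at x e) = card {0..<k x e}"
    unfolding card_atLeastLessThan_int using admissible_lifts(1)[OF assms] by linarith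
  ultimately have "\<exists>h. bij_betw h (lifts_at x e) {0..<k x e}"
    by (intro finite_same_card_bij) auto
  then have "bij_betw h (lifts_at x e) {0..<k x e}" unfolding h_def by (rule someI_ex)
  \<comment> \<open>All these lifts have the same tail and the same image, so \<open>pos\<close>
    uses one and the same choice on them.\<close>
  moreover have "pos f = h f" if "f \<in> lifts_at x e" for f
  proof -
    have "tlT f = x" "emap \<pi> f = e" using that by (simp_all add: lifts_def)
    then show ?thesis by (simp only: pos_def h_def)
  qed
  ultimately show ?thesis using bij_betw_cong[of "lifts_at x e" pos h] by blast
qed

text \<open>\<open>m x\<close> and \<open>label \<Gamma> e\<close> generate the multiples of
  \<open>k x e\<close>. Hence the residue of \<open>i\<close> picks the lift, and Bezout
  coefficients scaled by \<open>i div k x e\<close> supply \<open>j\<close> and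
  \<open>q\<close>.\<close>

lemma lift_exists:
  assumes "e \<in> EB" "x \<in> VT" "vmap \<pi> x = tlB e"
  obtains f j q where "f \<in> lifts_at x e" "i = pos f + label \<Gamma> e * j + m x * q"
proof -
  have "i mod k x e \<in> {0..<k x e}" using k_pos[OF assms(2)] by simp
  then obtain f where f: "f \<in> lifts_at x e" "pos f = i mod k x e"
    using bij_betw_pos[OF assms] by (metis bij_betw_imp_surj_on imageE)
  obtain a b where ab: "a * m x + b * label \<Gamma> e = k x e"
    unfolding k_def using bezout_int by blast
  have "pos f + label \<Gamma> e * (b * (i div k x e)) + m x * (a * (i div k x e)) =
      pos f + (a * m x + b * label \<Gamma> e) * (i div k x e)"
    by (simp add: algebra_simps)
  also have "\<dots> = i" unfolding ab f(2) by simp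
  finally have "i = pos f + label \<Gamma> e * (b * (i div k x e)) + m x * (a * (i div k x e))" by (rule sym)
  with f(1) show ?thesis by (rule that)
qed

text \<open>Modulo \<open>k x e\<close> only \<open>pos\<close> survives, so the lifts agree. There
  remains a linear relation between \<open>j - j'\<close> and \<open>q' - q\<close> whose
  coefficients, \<open>label \<Delta> f\<close> and \<open>emult \<pi> f\<close>, are coprime after
  the division by the gcd. The parameter \<open>s\<close> is an element of the edge group of
  \<open>f\<close>.\<close>

lemma lift_unique:
  assumes "e \<in> EB" "x \<in> VT" "vmap \<pi> x = tlB e" "f \<in> lifts_at x e" "f' \<in> lifts_at x e"
    and eq: "pos f + label \<Gamma> e * j + m x * q = pos f' + label \<Gamma> e * j' + m x * q'"
  obtains s where "f = f'" "j = j' + int (emult \<pi> f) * s" "q' = q + label \<Delta> f * s"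
proof -
  note lf = admissible_lifts(2,3)[OF assms(1-4)]
  have k: "k x e > 0" using k_pos assms(2) by simp
  have "k x e dvd m x" "k x e dvd label \<Gamma> e" by (simp_all add: k_def)
  then have "k x e dvd label \<Gamma> e * (j' - j) + m x * (q' - q)" by simp
  moreover have "pos f - pos f' = label \<Gamma> e * (j' - j) + m x * (q' - q)"
    using eq unfolding right_diff_distrib by linarith
  ultimately have "pos f mod k x e = pos f' mod k x e" by (simp add: mod_eq_dvd_iff)
  moreover have "pos f \<in> {0..<k x e}" "pos f' \<in> {0..<k x e}"
    using bij_betwE[OF bij_betw_pos[OF assms(1-3)]] assms(4,5) by blast+
  ultimately have "pos f = pos f'" by simp
  then have ff': "f = f'"
    using bij_betw_imp_inj_on[OF bij_betw_pos[OF assms(1-3)]] assms(4,5) by (meson inj_onD)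
  have "k x e * (label \<Delta> f * (j - j')) = label \<Gamma> e * (j - j')"
    unfolding lf(2)[symmetric] by simp
  also have "\<dots> = m x * (q' - q)" using eq ff' unfolding right_diff_distrib by simp
  also have "\<dots> = k x e * (int (emult \<pi> f) * (q' - q))"
    unfolding lf(1)[symmetric] by simp
  finally have *: "label \<Delta> f * (j - j') = int (emult \<pi> f) * (q' - q)" using k by simp
  have "gcd (int (emult \<pi> f)) (label \<Delta> f) * k x e = gcd (m x) (label \<Gamma> e)"
    unfolding lf[symmetric] gcd_mult_right using k by (simp add: gcd.commute)
  then have "coprime (int (emult \<pi> f)) (label \<Delta> f)"
    using k by (simp add: coprime_iff_gcd_eq_1 flip: k_def)
  then have "int (emult \<pi> f) dvd j - j' \<longleftrightarrow> int (emult \<pi> f) dvd label \<Delta> f * (j - j')"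
    by (simp add: coprime_dvd_mult_right_iff)
  then have "int (emult \<pi> f) dvd j - j'" using * by simp
  then obtain s where s: "j - j' = int (emult \<pi> f) * s" by blast
  have "int (emult \<pi> f) > 0" using assms(4) emult_pos by (simp add: lifts_def)
  with * s have "q' - q = label \<Delta> f * s" by simp
  with s ff' show ?thesis by (intro that[of s]) auto
qed

text \<open>Different lifts of one edge at one vertex must be told apart in the image, so the stable
  letter is shifted by \<open>pos f\<close>, a representative of the orbit. The shift at the far end
  is the negative of that of the opposite lift, so that opposite lifts have inverse images.\<close>

primrec push_letter :: "('a, 'b, int) letter \<Rightarrow> ('v, 'e, int) letter list" where
  "push_letter (Elt x n) = [Elt (vmap \<pi> x) (m x * n)]"
| "push_letter (Stable f) = [Elt (tlB (emap \<pi> f)) (pos f), Stable (emap \<pi> f),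
      Elt (hdB (emap \<pi> f)) (- pos (opposite \<Delta> f))]"

definition push :: "('a, 'b, int) letter list \<Rightarrow> ('v, 'e, int) letter list" where
  "push w = concat (map push_letter w)"

lemma push_simps [simp]:
  "push [] = []" "push (l # w) = push_letter l @ push w" "push (w @ w') = push w @ push w'"
  by (simp_all add: push_def)

lemma path_word_push:
  "total.path_word x w y \<Longrightarrow> base.path_word (vmap \<pi> x) (push w) (vmap \<pi> y)"
proof (induction w arbitrary: x)
  case Nil
  then show ?case by (auto simp: total.path_word_Nil base.path_word_Nil)
next
  case (Cons l w)
  then show ?case
    using Cons.IH[of "total.tgt l"]
    by (cases l) (auto simp: total.path_word_Cons base.path_word_Cons)
qed

lemma push_letter_in_lists: "l \<in> total.letters \<Longrightarrow> push_letter l \<in> lists base.letters"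
  by (cases l) auto

lemma push_in_lists: "w \<in> lists total.letters \<Longrightarrow> push w \<in> lists base.letters"
  by (induction w) (use push_letter_in_lists in auto)

lemma word_class_push_Stable:
  assumes f: "f \<in> ET"
  shows "base.word_class (push [Stable f, Stable (opposite \<Delta> f)]) = base.word_class []"
proof -
  let ?e = "emap \<pi> f"
  let ?v = "tlB ?e" and ?u = "hdB ?e" and ?r = "pos f" and ?r' = "pos (opposite \<Delta> f)"
  have e: "?e \<in> EB" using f by simp
  have "base.word_class (push [Stable f, Stable (opposite \<Delta> f)]) =
    base.word_class ([Elt ?v ?r, Stable ?e] @ [Elt ?u (- ?r'), Elt ?u ?r'] @
      [Stable (opposite \<Gamma> ?e), Elt ?v (- ?r)])"
    using f by simp
  also have "\<dots> = base.word_class ([Elt ?v ?r, Stable ?e] @ [] @ [Stable (opposite \<Gamma> ?e), Elt ?v (- ?r)])"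
    using e by (intro base.word_class_cong) (auto simp: base.word_class_Elt_add base.word_class_Elt_zero)
  also have "\<dots> = base.word_class ([Elt ?v ?r] @ [Stable ?e, Stable (opposite \<Gamma> ?e)] @ [Elt ?v (- ?r)])"
    by simp
  also have "\<dots> = base.word_class ([Elt ?v ?r] @ [] @ [Elt ?v (- ?r)])"
    using e base.word_class_inv_letter[of "Stable ?e"] by (intro base.word_class_cong) auto
  finally show ?thesis
    using e by (simp add: base.word_class_Elt_add base.word_class_Elt_zero)
qed

text \<open>By \<open>label_emult\<close> both sides come from the same edge group element
  \<open>emult \<pi> f * c\<close>, and the shifts by \<open>pos\<close> disappear because vertex
  groups are abelian.\<close>

lemma word_class_push_conj:
  assumes f: "f \<in> ET"
  shows "base.word_class (push [Stable f, Elt (hdT f) (label \<Delta> (opposite \<Delta> f) * c), Stable (opposite \<Delta> f)]) =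
    base.word_class (push [Elt (tlT f) (label \<Delta> f * c)])"
proof -
  let ?e = "emap \<pi> f"
  let ?v = "tlB ?e" and ?u = "hdB ?e" and ?r = "pos f" and ?r' = "pos (opposite \<Delta> f)"
  let ?n = "int (emult \<pi> f) * c"
  have e: "?e \<in> EB" using f by simp
  have le: "m (hdT f) * (label \<Delta> (opposite \<Delta> f) * c) = label \<Gamma> (opposite \<Gamma> ?e) * ?n"
      "m (tlT f) * (label \<Delta> f * c) = label \<Gamma> ?e * ?n"
    using label_emult[OF f] label_emult_opposite[OF f] by (simp_all flip: mult.assoc)
  have "base.word_class (push [Stable f, Elt (hdT f) (label \<Delta> (opposite \<Delta> f) * c), Stable (opposite \<Delta> f)]) =
    base.word_class ([Elt ?v ?r, Stable ?e, Elt ?u (- ?r')] @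
      [Elt ?u (label \<Gamma> (opposite \<Gamma> ?e) * ?n), Elt ?u ?r'] @ [Stable (opposite \<Gamma> ?e), Elt ?v (- ?r)])"
    using f by (simp add: le(1))
  also have "\<dots> = base.word_class ([Elt ?v ?r, Stable ?e, Elt ?u (- ?r')] @
      [Elt ?u (label \<Gamma> (opposite \<Gamma> ?e) * ?n + ?r')] @ [Stable (opposite \<Gamma> ?e), Elt ?v (- ?r)])"
    using e by (intro base.word_class_cong) (auto simp: base.word_class_Elt_add)
  also have "\<dots> = base.word_class ([Elt ?v ?r, Stable ?e] @
      [Elt ?u (- ?r'), Elt ?u (label \<Gamma> (opposite \<Gamma> ?e) * ?n + ?r')] @ [Stable (opposite \<Gamma> ?e), Elt ?v (- ?r)])"
    by simp
  also have "\<dots> = base.word_class ([Elt ?v ?r, Stable ?e] @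
      [Elt ?u (label \<Gamma> (opposite \<Gamma> ?e) * ?n)] @ [Stable (opposite \<Gamma> ?e), Elt ?v (- ?r)])"
    using e by (intro base.word_class_cong) (auto simp: base.word_class_Elt_add)
  also have "\<dots> = base.word_class ([Elt ?v ?r] @ [Elt ?v (label \<Gamma> ?e * ?n)] @ [Elt ?v (- ?r)])"
    using e base.rewr.conj[of ?e ?n "[Elt ?v ?r]" "[Elt ?v (- ?r)]"]
    by (intro base.word_class_rewr) auto
  also have "\<dots> = base.word_class ([] @ [Elt ?v ?r, Elt ?v (label \<Gamma> ?e * ?n)] @ [Elt ?v (- ?r)])"
    by simp
  also have "\<dots> = base.word_class ([] @ [Elt ?v (?r + label \<Gamma> ?e * ?n)] @ [Elt ?v (- ?r)])"
    using e by (intro base.word_class_cong) (auto simp: base.word_class_Elt_add)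
  finally show ?thesis
    using f by (simp add: base.word_class_Elt_add le(2))
qed

lemma word_class_push_rewr:
  assumes "total.rewr a b"
  shows "base.word_class (push a) = base.word_class (push b)"
  using assms
proof cases
  case (mult x g h xs ys)
  have "base.word_class (push [Elt x g, Elt x h]) = base.word_class (push [Elt x (g + h)])"
    using mult by (simp add: base.word_class_Elt_add distrib_left)
  then show ?thesis
    using mult push_in_lists[of xs] push_in_lists[of ys]
      base.word_class_cong[of "push [Elt x g, Elt x h]" "push [Elt x (g + h)]" "push xs" "push ys"]
    by simp
next
  case (one x xs ys)
  then show ?thesis
    using push_in_lists[of xs] push_in_lists[of ys]
      base.word_class_cong[of "push [Elt x 0]" "[]" "push xs" "push ys"]
    by (simp add: base.word_class_Elt_zero)
next
  case (inverse f xs ys)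
  then show ?thesis
    using push_in_lists[of xs] push_in_lists[of ys] word_class_push_Stable[of f]
      base.word_class_cong[of "push [Stable f, Stable (opposite \<Delta> f)]" "[]" "push xs" "push ys"]
    by simp
next
  case (conj f c xs ys)
  then show ?thesis
    using push_in_lists[of xs] push_in_lists[of ys] word_class_push_conj[of f c]
      base.word_class_cong[of "push [Stable f, Elt (hdT f) (label \<Delta> (opposite \<Delta> f) * c), Stable (opposite \<Delta> f)]"
        "push [Elt (tlT f) (label \<Delta> f * c)]" "push xs" "push ys"]
    by simp
qed

lemma word_class_push_cong:
  assumes "total.word_class w = total.word_class w'" "w \<in> lists total.letters"
  shows "base.word_class (push w) = base.word_class (push w')"
  using total.word_class_induct[OF assms, of "\<lambda>w. base.word_class (push w)"] word_class_push_rewr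
  by blast

text \<open>
  Points of the covering groupoid, decorated with elements of the group of \<open>\<Delta>\<close>: the triple
  \<open>(x, i, g)\<close> with \<open>0 \<le> i < m x\<close> stands for the product of the image of \<open>g\<close> with the
  \<open>i\<close>-th power of the generator at \<open>vmap \<pi> x\<close>.
\<close>

definition point :: "'a \<Rightarrow> int \<Rightarrow> ('a, 'b, int) letter list set \<Rightarrow>
    'a \<times> int \<times> ('a, 'b, int) letter list set" where
  "point x i g = (x, i mod m x, g \<otimes>\<^bsub>total.path_group\<^esub> total.word_class [Elt x (i div m x)])"

definition fibre :: "'v \<Rightarrow> ('a \<times> int \<times> ('a, 'b, int) letter list set) set" where
  "fibre v = {point x i g | x i g. x \<in> VT \<and> vmap \<pi> x = v \<and> g \<in> carrier total.path_group}"

text \<open>The effect of multiplying by \<open>Stable e\<close> when the exponent is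
  \<open>pos f + label \<Gamma> e * j + m x * q\<close>: the summand with \<open>j\<close> slides
  across \<open>e\<close>, and the rest together with the stable letter is the image of
  \<open>[Elt x q, Stable f]\<close>, provided the shift at the far end in
  \<open>push_letter\<close> is compensated by \<open>pos (opposite \<Delta> f)\<close>.\<close>

definition cross :: "'b \<Rightarrow> int \<Rightarrow> int \<Rightarrow> ('a, 'b, int) letter list set \<Rightarrow>
    'a \<times> int \<times> ('a, 'b, int) letter list set" where
  "cross f j q g = point (hdT f) (pos (opposite \<Delta> f) + label \<Gamma> (opposite \<Gamma> (emap \<pi> f)) * j)
     (g \<otimes>\<^bsub>total.path_group\<^esub> total.word_class [Elt (tlT f) q, Stable f])"

text \<open>The decomposition of \<open>i\<close> along a lift is chosen arbitrarily. It is not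
  unique, but the resulting point is, by \<open>cross_unique\<close>.\<close>

fun act :: "('v, 'e, int) letter \<Rightarrow> 'a \<times> int \<times> ('a, 'b, int) letter list set \<Rightarrow>
    'a \<times> int \<times> ('a, 'b, int) letter list set" where
  "act (Elt v n) (x, i, g) = point x (i + n) g"
| "act (Stable e) (x, i, g) =
    (SOME s. \<exists>f j q. f \<in> lifts_at x e \<and> i = pos f + label \<Gamma> e * j + m x * q \<and> s = cross f j q g)"

text \<open>Multiples of \<open>m x\<close> in the exponent are images of powers of the generator at
  \<open>x\<close>, and so can be traded for a factor in the group component.\<close>

lemma point_shift:
  assumes "x \<in> VT" "g \<in> carrier total.path_group"
  shows "point x (i + m x * s) g = point x i (g \<otimes>\<^bsub>total.path_group\<^esub> total.word_class [Elt x s])"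
proof -
  interpret group total.path_group by (rule total.group_path_group)
  have "total.word_class [Elt x ((i + m x * s) div m x)] =
      total.word_class [Elt x s] \<otimes>\<^bsub>total.path_group\<^esub> total.word_class [Elt x (i div m x)]"
    using assms m_pos[of x] by (simp add: total.word_class_Elt_add)
  then show ?thesis using assms by (simp add: point_def m_assoc)
qed

lemma act_Elt_point:
  assumes "x \<in> VT" "g \<in> carrier total.path_group"
  shows "act (Elt v n) (point x i g) = point x (i + n) g"
proof -
  have "act (Elt v n) (point x i g) =
      point x (i mod m x + n) (g \<otimes>\<^bsub>total.path_group\<^esub> total.word_class [Elt x (i div m x)])"
    by (simp add: point_def)
  also have "\<dots> = point x (i mod m x + n + m x * (i div m x)) g"
    by (rule point_shift[OF assms, symmetric])
  also have "i mod m x + n + m x * (i div m x) = i + n" by simp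
  finally show ?thesis .
qed

text \<open>Two decompositions differ by an element \<open>s\<close> of the edge group of
  \<open>f\<close>. At the head it contributes a multiple of \<open>m (hdT f)\<close>, that is, a
  power of the generator there; slid back across \<open>f\<close>, this accounts for the change from
  \<open>q\<close> to \<open>q'\<close>.\<close>

lemma cross_unique:
  assumes e: "e \<in> EB" "x \<in> VT" "vmap \<pi> x = tlB e" and f: "f \<in> lifts_at x e" "f' \<in> lifts_at x e"
    and eq: "pos f + label \<Gamma> e * j + m x * q = pos f' + label \<Gamma> e * j' + m x * q'"
    and g: "g \<in> carrier total.path_group"
  shows "cross f j q g = cross f' j' q' g"
proof -
  interpret group total.path_group by (rule total.group_path_group)
  obtain s where s: "f = f'" "j = j' + int (emult \<pi> f) * s" "q' = q + label \<Delta> f * s"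
    by (rule lift_unique[OF e f eq])
  have fe: "f \<in> ET" "tlT f = x" "emap \<pi> f = e" using f(1) by (auto simp: lifts_def)
  have "label \<Gamma> (opposite \<Gamma> e) * j = label \<Gamma> (opposite \<Gamma> e) * j' + m (hdT f) * (label \<Delta> (opposite \<Delta> f) * s)"
    using label_emult_opposite[OF fe(1)] fe(3) s(2)
    by (simp add: distrib_left flip: mult.assoc)
  then have "cross f j q g = point (hdT f) (pos (opposite \<Delta> f) + label \<Gamma> (opposite \<Gamma> e) * j')
      (g \<otimes>\<^bsub>total.path_group\<^esub> total.word_class [Elt x q, Stable f] \<otimes>\<^bsub>total.path_group\<^esub>
        total.word_class [Elt (hdT f) (label \<Delta> (opposite \<Delta> f) * s)])"
    using fe g e(2) by (simp add: cross_def point_shift flip: add.assoc)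
  also have "g \<otimes>\<^bsub>total.path_group\<^esub> total.word_class [Elt x q, Stable f] \<otimes>\<^bsub>total.path_group\<^esub>
        total.word_class [Elt (hdT f) (label \<Delta> (opposite \<Delta> f) * s)] =
      g \<otimes>\<^bsub>total.path_group\<^esub> (total.word_class [Elt x q] \<otimes>\<^bsub>total.path_group\<^esub>
        total.word_class [Elt x (label \<Delta> f * s), Stable f])"
    using fe g e(2) total.word_class_slide[OF fe(1), of s] by (simp add: m_assoc)
  also have "total.word_class [Elt x q] \<otimes>\<^bsub>total.path_group\<^esub>
        total.word_class [Elt x (label \<Delta> f * s), Stable f] =
      total.word_class [Elt x q, Elt x (label \<Delta> f * s)] \<otimes>\<^bsub>total.path_group\<^esub> total.word_class [Stable f]"
    using fe e(2) by simp
  also have "\<dots> = total.word_class [Elt x q', Stable f]"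
    using fe e(2) s(3) by (simp add: total.word_class_Elt_add)
  finally show ?thesis
    using s(1) fe by (simp add: cross_def)
qed

lemma act_Stable_point:
  assumes e: "e \<in> EB" "x \<in> VT" "vmap \<pi> x = tlB e" and f: "f \<in> lifts_at x e"
    and i: "i = pos f + label \<Gamma> e * j + m x * q" and g: "g \<in> carrier total.path_group"
  shows "act (Stable e) (point x i g) = cross f j q g"
proof -
  interpret group total.path_group by (rule total.group_path_group)
  let ?d = "i div m x"
  let ?g = "g \<otimes>\<^bsub>total.path_group\<^esub> total.word_class [Elt x ?d]"
  have fe: "f \<in> ET" "tlT f = x" "emap \<pi> f = e" using f by (auto simp: lifts_def)
  \<comment> \<open>\<open>act\<close> sees only the reduced exponent \<open>i mod m x\<close>. The
    quotient sits in the group component, and here it is moved back into the coefficient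
    \<open>q\<close>.\<close>
  have shift: "cross f' j' (?d + q') g = cross f' j' q' ?g" if "f' \<in> lifts_at x e" for f' j' q'
  proof -
    have f': "f' \<in> ET" "tlT f' = x" using that by (auto simp: lifts_def)
    have "total.word_class [Elt x (?d + q'), Stable f'] =
        total.word_class ([] @ [Elt x ?d, Elt x q'] @ [Stable f'])"
      using f' e(2) total.word_class_cong[of "[Elt x ?d, Elt x q']" "[Elt x (?d + q')]" "[]" "[Stable f']"]
      by (simp add: total.word_class_Elt_add)
    also have "\<dots> = total.word_class [Elt x ?d] \<otimes>\<^bsub>total.path_group\<^esub> total.word_class [Elt x q', Stable f']"
      using f' e(2) by simp
    finally show ?thesis using f' e(2) g by (simp add: cross_def m_assoc)
  qed
  let ?P = "\<lambda>s. \<exists>f j q. f \<in> lifts_at x e \<and> i mod m x = pos f + label \<Gamma> e * j + m x * q \<and> s = cross f j q ?g"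
  have mod: "i mod m x + m x * ?d = i" by simp
  have "m x * (q - ?d) = m x * q - m x * ?d" by (rule right_diff_distrib)
  then have "i mod m x = pos f + label \<Gamma> e * j + m x * (q - ?d)"
    using i mod by linarith
  then have "?P (cross f j (q - ?d) ?g)" using f by blast
  then have "?P (SOME s. ?P s)" by (rule someI[of ?P])
  moreover have "act (Stable e) (point x i g) = (SOME s. ?P s)"
    unfolding point_def by (rule act.simps(2))
  ultimately have "?P (act (Stable e) (point x i g))" by (simp only:)
  then obtain f' j' q' where f': "f' \<in> lifts_at x e" "i mod m x = pos f' + label \<Gamma> e * j' + m x * q'"
    and act: "act (Stable e) (point x i g) = cross f' j' q' ?g"
    by blast
  have "m x * (?d + q') = m x * ?d + m x * q'" by (rule distrib_left)
  then have "pos f + label \<Gamma> e * j + m x * q = pos f' + label \<Gamma> e * j' + m x * (?d + q')"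
    using f'(2) i mod by linarith
  then have "cross f j q g = cross f' j' (?d + q') g"
    by (rule cross_unique[OF e f f'(1) _ g])
  then show ?thesis using act shift[OF f'(1)] by simp
qed

text \<open>One computation for two relations: \<open>c = 0\<close> gives the inverse stable
  letters, general \<open>c\<close> the conjugation relation. The way back follows the opposite lift
  with coefficient 0 at the head, so that the two stable letters of \<Delta> cancel.\<close>

lemma act_opposite_cross:
  assumes f: "f \<in> ET" and g: "g \<in> carrier total.path_group"
  shows "act (Stable (opposite \<Gamma> (emap \<pi> f)))
      (act (Elt v (label \<Gamma> (opposite \<Gamma> (emap \<pi> f)) * c)) (cross f j q g)) =
    point (tlT f) (pos f + label \<Gamma> (emap \<pi> f) * (j + c) + m (tlT f) * q) g"
proof -
  interpret group total.path_group by (rule total.group_path_group)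
  let ?e = "emap \<pi> f" and ?x = "tlT f" and ?y = "hdT f"
  let ?g = "g \<otimes>\<^bsub>total.path_group\<^esub> total.word_class [Elt ?x q, Stable f]"
  have gc: "?g \<in> carrier total.path_group" using f g by simp
  have 1: "act (Elt v (label \<Gamma> (opposite \<Gamma> ?e) * c)) (cross f j q g) =
      point ?y (pos (opposite \<Delta> f) + label \<Gamma> (opposite \<Gamma> ?e) * (j + c)) ?g"
    unfolding cross_def using f gc by (simp add: act_Elt_point distrib_left add.assoc)
  have 2: "act (Stable (opposite \<Gamma> ?e))
      (point ?y (pos (opposite \<Delta> f) + label \<Gamma> (opposite \<Gamma> ?e) * (j + c)) ?g) =
    cross (opposite \<Delta> f) (j + c) 0 ?g"
  proof (rule act_Stable_point)
    show "opposite \<Delta> f \<in> lifts_at ?y (opposite \<Gamma> ?e)" using f by (simp add: lifts_def)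
  qed (use f gc in simp_all)
  have "act (Stable (opposite \<Gamma> ?e)) (act (Elt v (label \<Gamma> (opposite \<Gamma> ?e) * c)) (cross f j q g)) =
      cross (opposite \<Delta> f) (j + c) 0 ?g"
    unfolding 1 2 ..
  also have "\<dots> = point ?x (pos f + label \<Gamma> ?e * (j + c))
      (?g \<otimes>\<^bsub>total.path_group\<^esub> total.word_class [Elt ?y 0, Stable (opposite \<Delta> f)])"
    using f by (simp add: cross_def)
  also have "?g \<otimes>\<^bsub>total.path_group\<^esub> total.word_class [Elt ?y 0, Stable (opposite \<Delta> f)] =
      g \<otimes>\<^bsub>total.path_group\<^esub> total.word_class ([Elt ?x q, Stable f] @ [Elt ?y 0] @ [Stable (opposite \<Delta> f)])"
    using f g by (simp add: m_assoc)
  also have "total.word_class ([Elt ?x q, Stable f] @ [Elt ?y 0] @ [Stable (opposite \<Delta> f)]) =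
      total.word_class ([Elt ?x q, Stable f] @ [] @ [Stable (opposite \<Delta> f)])"
    using f by (intro total.word_class_cong) (auto simp: total.word_class_Elt_zero)
  also have "\<dots> = total.word_class ([Elt ?x q] @ [Stable f, Stable (opposite \<Delta> f)] @ [])" by simp
  also have "\<dots> = total.word_class ([Elt ?x q] @ [] @ [])"
    using f total.word_class_inv_letter[of "Stable f"] by (intro total.word_class_cong) auto
  finally show ?thesis using f g by (simp add: point_shift)
qed

lemma cross_in_fibre:
  assumes "f \<in> ET" "g \<in> carrier total.path_group"
  shows "cross f j q g \<in> fibre (hdB (emap \<pi> f))"
proof -
  interpret group total.path_group by (rule total.group_path_group)
  have "g \<otimes>\<^bsub>total.path_group\<^esub> total.word_class [Elt (tlT f) q, Stable f] \<in> carrier total.path_group"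
    using assms by simp
  moreover have "hdT f \<in> VT" "vmap \<pi> (hdT f) = hdB (emap \<pi> f)" using assms by auto
  ultimately show ?thesis unfolding fibre_def cross_def by blast
qed

lemma fibre_cases:
  assumes "s \<in> fibre v"
  obtains x i g where "s = point x i g" "x \<in> VT" "vmap \<pi> x = v" "g \<in> carrier total.path_group"
  using assms by (auto simp: fibre_def)

lemma fibre_arc_cases:
  assumes "e \<in> EB" "s \<in> fibre (tlB e)"
  obtains f j q g where "f \<in> ET" "emap \<pi> f = e" "g \<in> carrier total.path_group"
    "s = point (tlT f) (pos f + label \<Gamma> e * j + m (tlT f) * q) g" "act (Stable e) s = cross f j q g"
proof -
  obtain x i g where s: "s = point x i g" "x \<in> VT" "vmap \<pi> x = tlB e" "g \<in> carrier total.path_group"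
    using assms(2) by (rule fibre_cases)
  obtain f j q where f: "f \<in> lifts_at x e" "i = pos f + label \<Gamma> e * j + m x * q"
    using lift_exists[OF assms(1) s(2,3)] .
  have "f \<in> ET" "emap \<pi> f = e" "tlT f = x" using f(1) by (auto simp: lifts_def)
  then show ?thesis
    using that[of f g j q] s f act_Stable_point[OF assms(1) s(2,3) f s(4)] by simp
qed

lemma groupoid_action_fibre:
  "groupoid_action (skeleton \<Gamma>) (opposite \<Gamma>) (\<lambda>_. integer_group) (\<lambda>_. integer_group)
     (\<lambda>e c. label \<Gamma> e * c) fibre act"
proof unfold_locales
  fix l s assume "l \<in> base.letters" "s \<in> fibre (base.src l)"
  then show "act l s \<in> fibre (base.tgt l)"
  proof (cases l)
    case (Elt v n)
    then obtain x i g where s: "s = point x i g" "x \<in> VT" "vmap \<pi> x = v" "g \<in> carrier total.path_group"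
      using \<open>s \<in> fibre (base.src l)\<close> by (auto elim: fibre_cases)
    then show ?thesis using Elt by (auto simp: act_Elt_point fibre_def)
  next
    case (Stable e)
    then obtain f j q g where "f \<in> ET" "emap \<pi> f = e" "g \<in> carrier total.path_group"
      "act (Stable e) s = cross f j q g"
      using \<open>l \<in> base.letters\<close> \<open>s \<in> fibre (base.src l)\<close> by (auto elim: fibre_arc_cases)
    then show ?thesis using Stable cross_in_fibre by auto
  qed
next
  fix v g h s assume "s \<in> fibre v"
  then show "act (Elt v h) (act (Elt v g) s) = act (Elt v (g \<otimes>\<^bsub>integer_group\<^esub> h)) s"
    by (elim fibre_cases) (simp add: act_Elt_point add.assoc)
next
  fix v s assume "s \<in> fibre v"
  then show "act (Elt v \<one>\<^bsub>integer_group\<^esub>) s = s"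
    by (elim fibre_cases) (simp add: act_Elt_point)
next
  fix e s assume e: "e \<in> EB" "s \<in> fibre (tlB e)"
  then obtain f j q g where f: "f \<in> ET" "emap \<pi> f = e" "g \<in> carrier total.path_group"
    "s = point (tlT f) (pos f + label \<Gamma> e * j + m (tlT f) * q) g" "act (Stable e) s = cross f j q g"
    by (rule fibre_arc_cases)
  \<comment> \<open>A trivial power is inserted so that \<open>act_opposite_cross\<close> applies
    with \<open>c = 0\<close>.\<close>
  have "cross f j q g = act (Elt (hdB e) (label \<Gamma> (opposite \<Gamma> e) * 0)) (cross f j q g)"
    using cross_in_fibre[OF f(1,3), of j q] by (auto elim!: fibre_cases simp: act_Elt_point)
  then show "act (Stable (opposite \<Gamma> e)) (act (Stable e) s) = s"
    using act_opposite_cross[OF f(1,3), of "hdB e" 0 j q] f by simp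
next
  fix e c s assume e: "e \<in> EB" "s \<in> fibre (tlB e)"
  then obtain f j q g where f: "f \<in> ET" "emap \<pi> f = e" "g \<in> carrier total.path_group"
    "s = point (tlT f) (pos f + label \<Gamma> e * j + m (tlT f) * q) g" "act (Stable e) s = cross f j q g"
    by (rule fibre_arc_cases)
  then show "act (Stable (opposite \<Gamma> e)) (act (Elt (hdB e) (label \<Gamma> (opposite \<Gamma> e) * c)) (act (Stable e) s)) =
      act (Elt (tlB e) (label \<Gamma> e * c)) s"
    using act_opposite_cross[OF f(1,3), of "hdB e" c j q]
    by (simp add: act_Elt_point distrib_left algebra_simps)
qed

text \<open>The shift \<open>pos f\<close> in \<open>push_letter\<close> leads exactly to the
  crossing with \<open>j = q = 0\<close>, and the second shift then brings the exponent back to 0.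
  The group component meanwhile records the word read, and this is how a word is recovered from its
  image.\<close>

lemma fold_act_push:
  assumes "total.path_word x w y" "g \<in> carrier total.path_group"
  shows "fold act (push w) (point x 0 g) = point y 0 (g \<otimes>\<^bsub>total.path_group\<^esub> total.word_class w)"
proof -
  interpret group total.path_group by (rule total.group_path_group)
  show ?thesis
    using assms
  proof (induction w arbitrary: x g)
    case Nil
    have "g \<otimes>\<^bsub>total.path_group\<^esub> total.word_class [] = g"
      using r_one[OF Nil(2)] by simp
    with Nil(1) show ?case by (simp only: total.path_word_Nil push_simps fold_simps)
  next
    case (Cons l w)
    then have l: "l \<in> total.letters" "total.src l = x" "total.path_word (total.tgt l) w y"
      and g: "g \<in> carrier total.path_group"
      by (auto simp: total.path_word_Cons)
    have x: "x \<in> VT" using l total.src_in_verts by blast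
    have step: "fold act (push_letter l) (point x 0 g) =
        point (total.tgt l) 0 (g \<otimes>\<^bsub>total.path_group\<^esub> total.word_class [l])"
    proof (cases l)
      case (Elt x' n)
      then show ?thesis using l g x point_shift[of x g 0 n] by (simp add: act_Elt_point)
    next
      case (Stable f)
      then have f: "f \<in> ET" "tlT f = x" using l by auto
      have "act (Stable (emap \<pi> f)) (point x (pos f) g) = cross f 0 0 g"
        using f g x by (intro act_Stable_point) (auto simp: lifts_def)
      also have "\<dots> = point (hdT f) (pos (opposite \<Delta> f)) (g \<otimes>\<^bsub>total.path_group\<^esub> total.word_class [Stable f])"
        using f x total.word_class_cong[of "[Elt x 0]" "[]" "[]" "[Stable f]"]
        by (simp add: cross_def total.word_class_Elt_zero)
      finally show ?thesis using Stable f g x by (simp add: act_Elt_point)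
    qed
    have "total.word_class (l # w) = total.word_class [l] \<otimes>\<^bsub>total.path_group\<^esub> total.word_class w"
      using l total.path_word_in_lists by (intro total.word_class_Cons) auto
    then show ?case
      using Cons.IH[OF l(3)] step l g total.path_word_in_lists[OF l(3)] by (simp add: m_assoc)
  qed
qed

proposition word_class_push_inj:
  assumes "connected (skeleton \<Gamma>)" "total.path_word x w x" "total.path_word x w' x"
    and eq: "base.word_class (push w) = base.word_class (push w')"
  shows "total.word_class w = total.word_class w'"
proof -
  interpret group total.path_group by (rule total.group_path_group)
  interpret groupoid_action "skeleton \<Gamma>" "opposite \<Gamma>" "\<lambda>_. integer_group" "\<lambda>_. integer_group"
    "\<lambda>e c. label \<Gamma> e * c" fibre act
    by (rule groupoid_action_fibre)
  let ?s = "point x 0 \<one>\<^bsub>total.path_group\<^esub>"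
  have x: "x \<in> VT" using assms(2) total.path_word_verts by blast
  then have "?s \<in> fibre (vmap \<pi> x)" unfolding fibre_def by blast
  then have "fold act (push w) ?s = fold act (push w') ?s"
    using assms path_word_push[OF assms(2)] path_word_push[OF assms(3)] by (intro act_word_eq)
  then have "point x 0 (total.word_class w) = point x 0 (total.word_class w')"
    using fold_act_push[OF assms(2), of "\<one>\<^bsub>total.path_group\<^esub>"]
      fold_act_push[OF assms(3), of "\<one>\<^bsub>total.path_group\<^esub>"]
      total.path_word_in_lists[OF assms(2)] total.path_word_in_lists[OF assms(3)]
    by simp
  moreover have "point x 0 (total.word_class u) = (x, 0, total.word_class u)"
    if "total.path_word x u x" for u
    using total.path_word_in_lists[OF that] x by (simp add: point_def total.word_class_Elt_zero)
  ultimately show ?thesis using assms(2,3) by simp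
qed

text \<open>The leading power \<open>Elt v i\<close> is the carry of the induction: crossing an edge
  along a lift leaves a power at the head, which is handed to the rest of the word. It is reduced
  modulo \<open>m y\<close> only at the end of the path, which leaves finitely many
  remainders.\<close>

lemma push_covers:
  assumes "base.path_word v w u" "x \<in> VT" "vmap \<pi> x = v"
  shows "\<exists>y j z. total.path_word x z y \<and> vmap \<pi> y = u \<and> 0 \<le> j \<and> j < m y \<and>
    base.word_class (Elt v i # w) = base.word_class (push z @ [Elt u j])"
  using assms
proof (induction w arbitrary: v x i)
  case Nil
  let ?q = "i div m x" and ?j = "i mod m x"
  have "base.word_class (push [Elt x ?q] @ [Elt v ?j]) = base.word_class [Elt v i]"
    using Nil base.word_class_Elt_add[of v "m x * ?q" ?j] by (auto simp: base.path_word_Nil)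
  then show ?case
    using Nil m_pos[of x]
    by (intro exI[of _ x] exI[of _ ?j] exI[of _ "[Elt x ?q]"])
      (auto simp: total.path_word_Cons total.path_word_Nil base.path_word_Nil)
next
  case (Cons l w)
  then have l: "l \<in> base.letters" "base.src l = v" and w: "base.path_word (base.tgt l) w u"
    by (auto simp: base.path_word_Cons)
  have ws: "w \<in> lists base.letters" using w base.path_word_in_lists by blast
  show ?case
  proof (cases l)
    case (Elt v' n)
    then have "base.word_class ([] @ [Elt v i, l] @ w) = base.word_class ([] @ [Elt v (i + n)] @ w)"
      using l ws by (intro base.word_class_cong) (auto simp: base.word_class_Elt_add)
    then show ?thesis using Cons.IH[of v x "i + n"] w l Elt Cons.prems by simp
  next
    case (Stable e)
    then have e: "e \<in> EB" "tlB e = v" and w: "base.path_word (hdB e) w u" using l w by auto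
    obtain f j q where f: "f \<in> lifts_at x e" "i = pos f + label \<Gamma> e * j + m x * q"
      using lift_exists[of e x i] e Cons.prems by auto
    then have fe: "f \<in> ET" "emap \<pi> f = e" "tlT f = x" by (auto simp: lifts_def)
    let ?r = "pos f" and ?r' = "pos (opposite \<Delta> f)"
    \<comment> \<open>\<open>push_letter\<close> ends with the power \<open>- ?r'\<close>, so the
      carry must give \<open>?r'\<close> back.\<close>
    let ?i = "?r' + label \<Gamma> (opposite \<Gamma> e) * j"
    obtain y j' z where z: "total.path_word (hdT f) z y" "vmap \<pi> y = u" "0 \<le> j'" "j' < m y"
      "base.word_class (Elt (hdB e) ?i # w) = base.word_class (push z @ [Elt u j'])"
      using Cons.IH[of "hdB e" "hdT f" ?i] w fe by auto
    have u: "u \<in> VB" using w base.path_word_verts by blast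
    have pz: "push z \<in> lists base.letters" using z(1) push_in_lists total.path_word_in_lists by blast
    have i: "m x * q + (?r + label \<Gamma> e * j) = i" using f(2) by linarith
    have v: "v \<in> VB" "hdB e \<in> VB" using e by auto
    have "base.word_class ([] @ [Elt v i] @ (Stable e # w)) =
        base.word_class ([] @ [Elt v (m x * q), Elt v (?r + label \<Gamma> e * j)] @ (Stable e # w))"
      using e v ws i by (intro base.word_class_cong) (auto simp: base.word_class_Elt_add)
    also have "\<dots> = base.word_class ([Elt v (m x * q)] @ [Elt v (?r + label \<Gamma> e * j)] @ (Stable e # w))"
      by simp
    also have "\<dots> = base.word_class ([Elt v (m x * q)] @ [Elt v ?r, Elt v (label \<Gamma> e * j)] @ (Stable e # w))"
      using e v ws by (intro base.word_class_cong) (auto simp: base.word_class_Elt_add)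
    also have "\<dots> = base.word_class ([Elt v (m x * q), Elt v ?r] @ [Elt v (label \<Gamma> e * j), Stable e] @ w)"
      by simp
    also have "\<dots> = base.word_class ([Elt v (m x * q), Elt v ?r] @
        [Stable e, Elt (hdB e) (label \<Gamma> (opposite \<Gamma> e) * j)] @ w)"
      using e v ws base.word_class_slide[OF e(1), of j] by (intro base.word_class_cong) auto
    also have "\<dots> = base.word_class ([Elt v (m x * q), Elt v ?r, Stable e] @
        [Elt (hdB e) (label \<Gamma> (opposite \<Gamma> e) * j)] @ w)"
      by simp
    also have "\<dots> = base.word_class ([Elt v (m x * q), Elt v ?r, Stable e] @
        [Elt (hdB e) (- ?r'), Elt (hdB e) ?i] @ w)"
      using e v ws by (intro base.word_class_cong) (auto simp: base.word_class_Elt_add)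
    also have "\<dots> = base.word_class (push [Elt x q, Stable f] @ (Elt (hdB e) ?i # w) @ [])"
      using fe Cons.prems e by simp
    also have "\<dots> = base.word_class (push [Elt x q, Stable f] @ (push z @ [Elt u j']) @ [])"
      using z(5) e fe v ws Cons.prems by (intro base.word_class_cong) auto
    finally have "base.word_class (Elt v i # l # w) =
        base.word_class (push (Elt x q # Stable f # z) @ [Elt u j'])"
      using Stable by simp
    moreover have "total.path_word x (Elt x q # Stable f # z) y"
      using fe z(1) Cons.prems by (auto simp: total.path_word_Cons)
    ultimately show ?thesis using z(2-4) by blast
  qed
qed

end

section \<open>Admissible maps and subgroups of finite index\<close>

lemma finite_rcosets_iso:
  assumes "group G" "group F" and \<phi>: "\<phi> \<in> iso G F" and H: "subgroup H G"
    and fin: "finite (rcosets\<^bsub>G\<^esub> H)"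
  shows "finite (rcosets\<^bsub>F\<^esub> (\<phi> ` H))"
proof -
  have "rcosets\<^bsub>F\<^esub> (\<phi> ` H) \<subseteq> image \<phi> ` (rcosets\<^bsub>G\<^esub> H)"
  proof
    fix C assume "C \<in> rcosets\<^bsub>F\<^esub> (\<phi> ` H)"
    moreover have "carrier F = \<phi> ` carrier G" using \<phi> by (auto simp: iso_def bij_betw_def)
    ultimately obtain a where a: "a \<in> carrier G" "C = \<phi> ` H #>\<^bsub>F\<^esub> \<phi> a"
      by (auto simp: RCOSETS_def)
    have "\<phi> (h \<otimes>\<^bsub>G\<^esub> a) = \<phi> h \<otimes>\<^bsub>F\<^esub> \<phi> a" if "h \<in> H" for h
      using \<phi> a(1) that subgroup.mem_carrier[OF H] by (auto simp: iso_def hom_def)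
    then have "C = \<phi> ` (H #>\<^bsub>G\<^esub> a)"
      unfolding a(2) by (auto simp: r_coset_def image_iff)
    then show "C \<in> image \<phi> ` (rcosets\<^bsub>G\<^esub> H)"
      using a(1) by (auto simp: RCOSETS_def)
  qed
  then show ?thesis using fin finite_surj by blast
qed

context admissible_map
begin

definition push_class :: "('a, 'b, int) letter list set \<Rightarrow> ('v, 'e, int) letter list set" where
  "push_class C = base.word_class (push (SOME w. w \<in> C))"

lemma push_class_word_class:
  assumes "w \<in> lists total.letters"
  shows "push_class (total.word_class w) = base.word_class (push w)"
proof -
  have "(SOME w'. w' \<in> total.word_class w) \<in> total.word_class w"
    using total.word_class_self by (rule someI)
  then show ?thesis
    unfolding push_class_def using word_class_push_cong[OF _ assms] by (metis total.mem_word_class)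
qed

lemma push_class_hom:
  "x \<in> VT \<Longrightarrow> push_class \<in> hom (total.fundamental_group x) (base.fundamental_group (vmap \<pi> x))"
proof (rule homI)
  fix a assume "a \<in> carrier (total.fundamental_group x)"
  then obtain w where "a = total.word_class w" "total.path_word x w x"
    by (auto simp: total.carrier_fundamental_group)
  then show "push_class a \<in> carrier (base.fundamental_group (vmap \<pi> x))"
    using total.path_word_in_lists path_word_push
    by (auto simp: base.carrier_fundamental_group push_class_word_class)
next
  fix a b assume "a \<in> carrier (total.fundamental_group x)" "b \<in> carrier (total.fundamental_group x)"
  then obtain w w' where w: "a = total.word_class w" "total.path_word x w x"
    "b = total.word_class w'" "total.path_word x w' x"
    by (auto simp: total.carrier_fundamental_group)
  then have "w \<in> lists total.letters" "w' \<in> lists total.letters"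
    using total.path_word_in_lists by blast+
  moreover from this have "push w \<in> lists base.letters" "push w' \<in> lists base.letters"
    using push_in_lists by blast+
  ultimately show "push_class (a \<otimes>\<^bsub>total.fundamental_group x\<^esub> b) =
      push_class a \<otimes>\<^bsub>base.fundamental_group (vmap \<pi> x)\<^esub> push_class b"
    unfolding w by (simp add: total.mult_fundamental_group base.mult_fundamental_group
        push_class_word_class)
qed

lemma push_class_inj_on:
  assumes "connected (skeleton \<Gamma>)"
  shows "inj_on push_class (carrier (total.fundamental_group x))"
proof (rule inj_onI)
  fix a b assume "a \<in> carrier (total.fundamental_group x)" "b \<in> carrier (total.fundamental_group x)"
    and eq: "push_class a = push_class b"
  then obtain w w' where w: "a = total.word_class w" "total.path_word x w x"
    "b = total.word_class w'" "total.path_word x w' x"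
    by (auto simp: total.carrier_fundamental_group)
  then show "a = b"
    using word_class_push_inj[OF assms w(2,4)] eq total.path_word_in_lists
    by (simp add: push_class_word_class)
qed

definition push_image :: "'a \<Rightarrow> ('v, 'e, int) letter list set set" where
  "push_image x = push_class ` carrier (total.fundamental_group x)"

lemma subgroup_push_image:
  assumes "x \<in> VT"
  shows "subgroup (push_image x) (base.fundamental_group (vmap \<pi> x))"
  unfolding push_image_def
  by (intro group_hom.img_is_subgroup group_hom.intro group_hom_axioms.intro push_class_hom
      total.group_fundamental_group base.group_fundamental_group vmap_in_verts assms)

lemma push_class_iso:
  assumes "connected (skeleton \<Gamma>)" "x \<in> VT"
  shows "push_class \<in> iso (total.fundamental_group x)
    ((base.fundamental_group (vmap \<pi> x))\<lparr>carrier := push_image x\<rparr>)"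
  using push_class_hom[OF assms(2)] push_class_inj_on[OF assms(1), of x]
  by (auto simp: iso_def hom_def bij_betw_def push_image_def)

lemma finite_rcosets_push_image:
  assumes x: "x \<in> VT"
  shows "finite (rcosets\<^bsub>base.fundamental_group (vmap \<pi> x)\<^esub> push_image x)"
proof -
  let ?v = "vmap \<pi> x"
  let ?F = "base.fundamental_group ?v"
  interpret F: group ?F using x by (intro base.group_fundamental_group) simp
  \<comment> \<open>One path to each \<open>y\<close>, independent of the word considered. Replacing
    \<open>z\<close> by it changes the element only by the image of the loop \<open>u\<close>, so a
    coset is determined by \<open>y\<close> and \<open>j\<close>.\<close>
  define p where "p y = (SOME z. total.path_word x z y)" for y
  define rep where "rep y j = base.word_class (push (p y) @ [Elt ?v j])" for y j
  let ?I = "SIGMA y:{y \<in> VT. vmap \<pi> y = ?v}. {0..<m y}"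
  have "rcosets\<^bsub>?F\<^esub> push_image x \<subseteq> (\<lambda>(y, j). push_image x #>\<^bsub>?F\<^esub> rep y j) ` ?I"
  proof
    fix C assume "C \<in> rcosets\<^bsub>?F\<^esub> push_image x"
    then obtain a where a: "a \<in> carrier ?F" "C = push_image x #>\<^bsub>?F\<^esub> a"
      by (auto simp: RCOSETS_def)
    then obtain w where w: "a = base.word_class w" "base.path_word ?v w ?v"
      by (auto simp: base.carrier_fundamental_group)
    obtain y j z where z: "total.path_word x z y" "vmap \<pi> y = ?v" "0 \<le> j" "j < m y"
      "base.word_class (Elt ?v 0 # w) = base.word_class (push z @ [Elt ?v j])"
      using push_covers[OF w(2) x refl] by blast
    have y: "y \<in> VT" using z(1) total.path_word_verts by blast
    have py: "total.path_word x (p y) y" unfolding p_def using z(1) by (rule someI)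
    define u where "u = z @ total.inv_word (p y)"
    have u: "total.path_word x u x"
      unfolding u_def using z(1) total.path_word_inv[OF py] by (auto simp: total.path_word_append)
    have rep_path: "base.path_word ?v (push (p y) @ [Elt ?v j]) ?v"
      using path_word_push[OF py] z(2) x
      by (auto simp: base.path_word_append base.path_word_Cons base.path_word_Nil)
    note lists = base.path_word_in_lists[OF w(2)] total.path_word_in_lists[OF u]
      total.path_word_in_lists[OF z(1)] total.path_word_in_lists[OF py]
    note push_lists = lists(2-4)[THEN push_in_lists] base.path_word_in_lists[OF rep_path]
    have "a = base.word_class ([] @ [Elt ?v 0] @ w)"
      using x lists(1) base.word_class_cong[of "[Elt ?v 0]" "[]" "[]" w]
      by (simp add: w(1) base.word_class_Elt_zero)
    also have "\<dots> = base.word_class (push z @ [] @ [Elt ?v j])" using z(5) by simp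
    also have "\<dots> = base.word_class (push z @ push (total.inv_word (p y) @ p y) @ [Elt ?v j])"
      using lists push_lists x word_class_push_cong[OF total.word_class_inv_word_left[OF lists(4)]]
      by (intro base.word_class_cong) auto
    also have "\<dots> = base.word_class (push u) \<otimes>\<^bsub>base.path_group\<^esub> rep y j"
      using push_lists unfolding rep_def by (simp add: u_def)
    finally have a_eq: "a = base.word_class (push u) \<otimes>\<^bsub>?F\<^esub> rep y j"
      by (simp add: base.mult_fundamental_group)
    have "push_class (total.word_class u) \<in> push_image x"
      using u unfolding push_image_def total.carrier_fundamental_group by blast
    then have "base.word_class (push u) \<in> push_image x"
      using push_class_word_class[OF lists(2)] by simp
    then have "a \<in> push_image x #>\<^bsub>?F\<^esub> rep y j"
      unfolding a_eq r_coset_def by blast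
    moreover have "rep y j \<in> carrier ?F"
      unfolding rep_def base.carrier_fundamental_group using rep_path by blast
    ultimately have "C = push_image x #>\<^bsub>?F\<^esub> rep y j"
      unfolding a(2) using F.repr_independence subgroup_push_image[OF x] by blast
    then show "C \<in> (\<lambda>(y, j). push_image x #>\<^bsub>?F\<^esub> rep y j) ` ?I"
      using y z(2-4) by force
  qed
  moreover have "finite ?I"
    using fin_digraph.finite_verts[OF total.fin] by auto
  ultimately show ?thesis using finite_surj by blast
qed

end

theorem admissible_map_finite_index:
  fixes A :: "'g monoid"
  assumes A: "group A" "A \<cong> labelled_graph_group \<Gamma> (vmap \<pi> x)"
    and \<Gamma>: "connected_labelled_graph \<Gamma>" and \<Delta>: "connected_labelled_graph \<Delta>"
    and adm: "admissible \<Delta> \<Gamma> \<pi>" and x: "x \<in> verts (skeleton \<Delta>)"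
  shows "\<exists>H. subgroup H A \<and> finite (rcosets\<^bsub>A\<^esub> H) \<and> represented_by (A\<lparr>carrier := H\<rparr>) \<Delta>"
proof -
  interpret admissible_map \<Gamma> \<Delta> \<pi>
    using \<Gamma> \<Delta> adm
    by (simp add: admissible_map_def admissible_map_axioms_def connected_labelled_graph_def)
  have conn: "connected (skeleton \<Gamma>)" using \<Gamma> by (simp add: connected_labelled_graph_def)
  let ?F = "base.fundamental_group (vmap \<pi> x)" and ?H = "push_image x"
  interpret F: group ?F using x by (intro base.group_fundamental_group) simp
  have "?F \<cong> A" using group.iso_sym[OF A] by (simp add: labelled_graph_group_def)
  then obtain \<phi> where \<phi>: "\<phi> \<in> iso ?F A" by (auto simp: is_iso_def)
  note H = subgroup_push_image[OF x]
  have "total.fundamental_group x \<cong> A\<lparr>carrier := \<phi> ` ?H\<rparr>"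
    using iso_set_trans[OF push_class_iso[OF conn x] iso_restrict[OF \<phi> F.is_group A(1) H]]
    by (auto simp: is_iso_def)
  then have "A\<lparr>carrier := \<phi> ` ?H\<rparr> \<cong> labelled_graph_group \<Delta> x"
    using group.iso_sym[OF total.group_fundamental_group[OF x]] by (simp add: labelled_graph_group_def)
  then have "represented_by (A\<lparr>carrier := \<phi> ` ?H\<rparr>) \<Delta>"
    using \<Delta> x by (auto simp: represented_by_def)
  moreover have "subgroup (\<phi> ` ?H) A"
    using subgroup.iso_subgroup[OF H F.is_group A(1) \<phi>] .
  moreover have "finite (rcosets\<^bsub>A\<^esub> (\<phi> ` ?H))"
    by (rule finite_rcosets_iso[OF F.is_group A(1) \<phi> H finite_rcosets_push_image[OF x]])
  ultimately show ?thesis by blast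
qed

section \<open>Multiplicities without plateaus\<close>

text \<open>With \<open>n = a * g\<close>, \<open>l = b * g\<close> and \<open>a\<close>,
  \<open>b\<close> coprime, the new gcd is \<open>gcd p b * g\<close>. Thus the factor
  \<open>p\<close> is absorbed by the gcd if \<open>p\<close> divides \<open>b\<close>, and
  otherwise survives in the quotient, which is the edge multiplicity when \<open>n\<close> is that
  of a vertex.\<close>

lemma quotient_raise_prime:
  fixes n l p :: int
  assumes "prime p" "n > 0"
  shows "(p * n) div gcd (p * n) l = (if p dvd l div gcd n l then n div gcd n l else p * (n div gcd n l))"
proof -
  define g where "g = gcd n l"
  define a where "a = n div g"
  define b where "b = l div g"
  have g: "g > 0" using assms(2) by (simp add: g_def)
  have n: "n = a * g" and l: "l = b * g" by (simp_all add: a_def b_def g_def)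
  have ab: "coprime a b"
    unfolding a_def b_def g_def using assms(2) by (intro div_gcd_coprime) auto
  have "gcd (p * n) l = gcd ((p * a) * g) (b * g)" by (simp add: n l mult.assoc)
  also have "\<dots> = gcd (p * a) b * g" using g by (simp add: gcd_mult_right gcd.commute)
  also have "gcd (p * a) b = gcd p b" using ab by (simp add: gcd_mult_left_right_cancel coprime_commute)
  also have "gcd p b = (if p dvd b then p else 1)"
    using prime_gt_0_int[OF assms(1)] prime_imp_coprime[OF assms(1), of b] by auto
  finally have "gcd (p * n) l = (if p dvd b then p else 1) * g" .
  moreover have "p > 0" using assms(1) by (rule prime_gt_0_int)
  ultimately show ?thesis
    unfolding g_def[symmetric] a_def[symmetric] b_def[symmetric] using g
    by (auto simp: n)
qed

context labelled_graph
begin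

interpretation fin_digraph "skeleton \<Gamma>" by (rule fin)

abbreviation org :: "'e \<Rightarrow> 'v" where "org \<equiv> tail (skeleton \<Gamma>)"
abbreviation trm :: "'e \<Rightarrow> 'v" where "trm \<equiv> head (skeleton \<Gamma>)"

definition edge_gcd :: "('v \<Rightarrow> nat) \<Rightarrow> 'e \<Rightarrow> int" where
  "edge_gcd N e = gcd (int (N (org e))) (label \<Gamma> e)"

definition edge_mult :: "('v \<Rightarrow> nat) \<Rightarrow> 'e \<Rightarrow> int" where
  "edge_mult N e = int (N (org e)) div edge_gcd N e"

definition edge_label :: "('v \<Rightarrow> nat) \<Rightarrow> 'e \<Rightarrow> int" where
  "edge_label N e = label \<Gamma> e div edge_gcd N e"

definition balanced :: "('v \<Rightarrow> nat) \<Rightarrow> bool" where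
  "balanced N \<longleftrightarrow> (\<forall>v \<in> verts (skeleton \<Gamma>). N v > 0) \<and>
    (\<forall>e \<in> arcs (skeleton \<Gamma>). edge_mult N (opposite \<Gamma> e) = edge_mult N e)"

text \<open>
  The closure property which the projection of a \<open>p\<close>-plateau inherits from a covering graph
  with multiplicities \<open>N\<close>.
\<close>

definition plateau_support :: "('v \<Rightarrow> nat) \<Rightarrow> int \<Rightarrow> 'v set \<Rightarrow> bool" where
  "plateau_support N p S \<longleftrightarrow> S \<subseteq> verts (skeleton \<Gamma>) \<and>
    (\<forall>e \<in> arcs (skeleton \<Gamma>). org e \<in> S \<longrightarrow> \<not> p dvd edge_label N e \<longrightarrow>
      trm e \<in> S \<and> \<not> p dvd edge_label N (opposite \<Gamma> e))"

lemma edge_gcd_pos: "balanced N \<Longrightarrow> e \<in> arcs (skeleton \<Gamma>) \<Longrightarrow> edge_gcd N e > 0"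
  using label_nonzero[of e] by (simp add: edge_gcd_def)

lemma edge_mult_gcd: "edge_mult N e * edge_gcd N e = int (N (org e))"
  by (simp add: edge_mult_def edge_gcd_def)

lemma edge_label_gcd: "edge_label N e * edge_gcd N e = label \<Gamma> e"
  by (simp add: edge_label_def edge_gcd_def)

text \<open>\<open>N (trm e)\<close> is the edge multiplicity times a gcd; the former divides
  \<open>N (org e)\<close>, the latter the label at the far end.\<close>

lemma balanced_head_dvd:
  assumes "balanced N" "e \<in> arcs (skeleton \<Gamma>)"
  shows "int (N (trm e)) dvd int (N (org e)) * label \<Gamma> (opposite \<Gamma> e)"
proof -
  have "int (N (trm e)) = edge_mult N e * edge_gcd N (opposite \<Gamma> e)"
    using edge_mult_gcd[of N "opposite \<Gamma> e"] assms by (simp add: balanced_def)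
  moreover have "edge_mult N e dvd int (N (org e))" using edge_mult_gcd by (metis dvd_triv_left)
  moreover have "edge_gcd N (opposite \<Gamma> e) dvd label \<Gamma> (opposite \<Gamma> e)" by (simp add: edge_gcd_def)
  ultimately show ?thesis by (simp add: mult_dvd_mono)
qed

text \<open>Computed at its origin, the multiplicity of \<open>e\<close> gains a factor
  \<open>p\<close> exactly when the origin lies in \<open>S\<close> and \<open>p\<close> does not
  divide the covering label there. Applied to \<open>e\<close> and to its opposite,
  \<open>plateau_support\<close> makes this condition independent of the orientation.\<close>

lemma balanced_raise:
  assumes N: "balanced N" and p: "prime p" and S: "plateau_support N (int p) S"
  shows "balanced (\<lambda>v. if v \<in> S then p * N v else N v)" (is "balanced ?N")
proof -
  have pos: "?N v > 0" if "v \<in> verts (skeleton \<Gamma>)" for v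
    using that N p by (auto simp: balanced_def prime_gt_0_nat)
  have raise: "edge_mult ?N e = (if org e \<in> S \<and> \<not> int p dvd edge_label N e then int p * edge_mult N e
      else edge_mult N e)" if "e \<in> arcs (skeleton \<Gamma>)" for e
  proof -
    have "int (N (org e)) > 0" using N that by (auto simp: balanced_def)
    then show ?thesis
      using quotient_raise_prime[of "int p" "int (N (org e))" "label \<Gamma> e"] p
      by (auto simp: edge_mult_def edge_label_def edge_gcd_def)
  qed
  have "edge_mult ?N (opposite \<Gamma> e) = edge_mult ?N e" if e: "e \<in> arcs (skeleton \<Gamma>)" for e
  proof -
    have "(org e \<in> S \<and> \<not> int p dvd edge_label N e) =
        (trm e \<in> S \<and> \<not> int p dvd edge_label N (opposite \<Gamma> e))"
      using S e unfolding plateau_support_def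
      by (metis arev_arev arev_in_arcs head_arev tail_arev)
    then show ?thesis
      using N e unfolding raise[OF e] raise[OF arev_in_arcs[OF e]] by (simp add: balanced_def)
  qed
  with pos show ?thesis unfolding balanced_def by blast
qed

text \<open>Each edge of a path costs at most one factor of the product of all labels, so the
  exponent is read off the graph alone; summing over all pairs of vertices makes it uniform.\<close>

lemma balanced_dvd_bound:
  assumes "connected (skeleton \<Gamma>)"
  obtains K where "\<And>N v w. balanced N \<Longrightarrow> v \<in> verts (skeleton \<Gamma>) \<Longrightarrow> w \<in> verts (skeleton \<Gamma>) \<Longrightarrow>
    int (N w) dvd int (N v) * (\<Prod>e \<in> arcs (skeleton \<Gamma>). label \<Gamma> e) ^ K"
proof -
  let ?V = "verts (skeleton \<Gamma>)"
  let ?L = "\<Prod>e \<in> arcs (skeleton \<Gamma>). label \<Gamma> e"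
  have "\<exists>d. \<forall>N. balanced N \<longrightarrow> int (N w) dvd int (N v) * ?L ^ d" if "v \<in> ?V" "w \<in> ?V" for v w
  proof -
    have "v \<rightarrow>\<^sup>*\<^bsub>skeleton \<Gamma>\<^esub> w"
      using symmetric_connected_imp_strongly_connected[OF sym_arcs assms] that
      by (auto simp: strongly_connected_def)
    then show ?thesis
    proof (induction rule: reachable_induct)
      case base
      have "\<forall>N. balanced N \<longrightarrow> int (N v) dvd int (N v) * ?L ^ 0" by simp
      then show ?case ..
    next
      case (step x y)
      then obtain d where d: "\<And>N. balanced N \<Longrightarrow> int (N x) dvd int (N v) * ?L ^ d" by blast
      obtain e where e: "e \<in> arcs (skeleton \<Gamma>)" "org e = x" "trm e = y" using step(2) by blast
      have "int (N y) dvd int (N v) * ?L ^ Suc d" if N: "balanced N" for N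
      proof -
        have "int (N y) dvd int (N x) * label \<Gamma> (opposite \<Gamma> e)"
          using balanced_head_dvd[OF N e(1)] e by simp
        also have "\<dots> dvd int (N x) * ?L"
          using e(1) by (intro mult_dvd_mono dvd_prodI) auto
        also have "\<dots> dvd (int (N v) * ?L ^ d) * ?L" by (intro mult_dvd_mono d N) simp
        finally show ?thesis by (simp add: mult_ac)
      qed
      then show ?case by blast
    qed
  qed
  then obtain d where d: "\<And>v w N. v \<in> ?V \<Longrightarrow> w \<in> ?V \<Longrightarrow> balanced N \<Longrightarrow>
      int (N w) dvd int (N v) * ?L ^ d v w"
    by metis
  define K where "K = (\<Sum>(v, w) \<in> ?V \<times> ?V. d v w)"
  have "int (N w) dvd int (N v) * ?L ^ K" if "balanced N" "v \<in> ?V" "w \<in> ?V" for N v w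
  proof -
    have "d v w \<le> K"
      unfolding K_def using that member_le_sum[of "(v, w)" "?V \<times> ?V" "\<lambda>(v, w). d v w"] by simp
    then have "?L ^ d v w dvd ?L ^ K" by (rule le_imp_power_dvd)
    then show ?thesis using d[OF that(2,3,1)] by (meson dvd_refl dvd_trans mult_dvd_mono)
  qed
  then show ?thesis by (rule that)
qed

text \<open>Only the \<open>p\<close>-part of \<open>int p * n\<close> is in question. As
  \<open>p\<close> divides \<open>l div g\<close>, it is prime to \<open>n0 div g\<close>, so
  \<open>pn\<close> bounds this part by \<open>int p * g * L ^ K\<close>; and
  \<open>int p * g\<close> divides \<open>l\<close>, which one more factor \<open>L\<close>
  absorbs.\<close>

lemma raise_dvd_bound:
  fixes p :: nat and n n0 l L :: int
  assumes p: "prime p" and n0: "n0 > 0" and p_dvd: "int p dvd l div gcd n0 l"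
    and l: "l dvd L" and n: "n dvd L ^ Suc K" "n > 0" and pn: "int p * n dvd (int p * n0) * L ^ K"
  shows "int p * n dvd L ^ Suc K"
proof -
  define g where "g = gcd n0 l"
  define a where "a = n0 div g"
  have ng: "n0 = a * g" "l = (l div g) * g" by (simp_all add: a_def g_def)
  have "coprime a (l div g)" unfolding a_def g_def using n0 by (intro div_gcd_coprime) auto
  then have pa: "coprime (int p) a" using p_dvd unfolding g_def
    by (meson coprime_commute coprime_divisors dvd_refl)
  have "n \<noteq> 0" "\<not> is_unit (int p)" using n(2) p by auto
  then obtain n' where n': "n = int p ^ multiplicity (int p) n * n'" "\<not> int p dvd n'"
    by (rule multiplicity_decompose')
  let ?s = "multiplicity (int p) n"
  have "int p ^ Suc ?s dvd int p * n" using n'(1) by (metis dvd_triv_left mult.assoc power_Suc)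
  also note pn
  also have "int p * n0 * L ^ K = a * (int p * g * L ^ K)" by (simp add: ng(1) mult_ac)
  finally have "int p ^ Suc ?s dvd int p * g * L ^ K"
    using pa by (simp add: coprime_dvd_mult_right_iff del: power_Suc)
  also have "int p * g dvd l" using p_dvd ng(2) unfolding g_def by (metis dvd_refl mult_dvd_mono)
  then have "int p * g * L ^ K dvd L * L ^ K" using l by (intro mult_dvd_mono) (auto intro: dvd_trans)
  finally have 1: "int p ^ Suc ?s dvd L ^ Suc K" by simp
  have 2: "n' dvd L ^ Suc K" using n'(1) n(1) by (metis dvd_mult_right)
  have "coprime (int p ^ Suc ?s) n'"
    using p n'(2) by (simp add: prime_imp_coprime del: power_Suc)
  then have "int p ^ Suc ?s * n' dvd L ^ Suc K" by (rule divides_mult[OF 1 2])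
  then show ?thesis using n'(1) by (metis mult.assoc power_Suc)
qed

proposition exists_balanced_without_plateau:
  assumes conn: "connected (skeleton \<Gamma>)"
  shows "\<exists>N. balanced N \<and> (\<forall>p S e. prime p \<longrightarrow> plateau_support N (int p) S \<longrightarrow>
    e \<in> arcs (skeleton \<Gamma>) \<longrightarrow> org e \<in> S \<longrightarrow> \<not> int p dvd edge_label N e)"
proof -
  let ?V = "verts (skeleton \<Gamma>)"
  define L where "L = (\<Prod>e \<in> arcs (skeleton \<Gamma>). label \<Gamma> e)"
  have L: "L \<noteq> 0" using label_nonzero by (simp add: L_def)
  obtain K where K: "\<And>N v w. balanced N \<Longrightarrow> v \<in> ?V \<Longrightarrow> w \<in> ?V \<Longrightarrow> int (N w) dvd int (N v) * L ^ K"
    unfolding L_def using balanced_dvd_bound[OF conn] by blast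
  \<comment> \<open>The exponent exceeds \<open>K\<close> by one to make room for the label of the
    edge where \<open>p\<close> divides the covering label.\<close>
  define P where "P N \<longleftrightarrow> balanced N \<and> (\<forall>v \<in> ?V. int (N v) dvd L ^ Suc K)" for N
  define f where "f N = (\<Sum>v \<in> ?V. N v)" for N :: "'v \<Rightarrow> nat"
  \<comment> \<open>Constant multiplicity 1 makes all gcds and all edge multiplicities equal to
    1.\<close>
  have "P (\<lambda>_. 1)" by (simp add: P_def balanced_def edge_mult_def edge_gcd_def)
  moreover have "f N < Suc (card ?V * nat \<bar>L ^ Suc K\<bar>)" if "P N" for N
  proof -
    have "N v \<le> nat \<bar>L ^ Suc K\<bar>" if "v \<in> ?V" for v
      using that \<open>P N\<close> L dvd_imp_le_int[of "L ^ Suc K" "int (N v)"] unfolding P_def by fastforce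
    then show ?thesis unfolding f_def using sum_bounded_above[of ?V N] by (simp add: le_imp_less_Suc)
  qed
  ultimately obtain N where N: "P N" and max: "\<And>N'. P N' \<Longrightarrow> f N' \<le> f N"
    using ex_has_greatest_nat[of P _ f] by blast
  have "\<not> int p dvd edge_label N e"
    if p: "prime p" and S: "plateau_support N (int p) S" and e: "e \<in> arcs (skeleton \<Gamma>)" "org e \<in> S" for p S e
  proof
    assume p_dvd: "int p dvd edge_label N e"
    let ?N = "\<lambda>v. if v \<in> S then p * N v else N v"
    have bal: "balanced N" "balanced ?N" using N balanced_raise[OF _ p S] by (auto simp: P_def)
    have pos: "\<And>v. v \<in> ?V \<Longrightarrow> N v > 0" using bal(1) by (simp add: balanced_def)
    have SV: "S \<subseteq> ?V" using S by (simp add: plateau_support_def)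
    have "int (?N w) dvd L ^ Suc K" if w: "w \<in> ?V" for w
    proof (cases "w \<in> S")
      case True
      \<comment> \<open>\<open>K\<close> applies to the raised function too. Both \<open>w\<close>
        and \<open>org e\<close> lie in \<open>S\<close>, so each side acquires the factor
        \<open>p\<close>.\<close>
      have "int p * int (N w) dvd (int p * int (N (org e))) * L ^ K"
        using K[OF bal(2) _ w, of "org e"] e True by simp
      then have "int p * int (N w) dvd L ^ Suc K"
        using p_dvd p N w pos e
        by (intro raise_dvd_bound[where ?n0.0 = "int (N (org e))" and l = "label \<Gamma> e"])
          (auto simp: edge_label_def edge_gcd_def L_def P_def intro: dvd_prodI)
      then show ?thesis using True by simp
    next
      case False
      then show ?thesis using N w by (simp add: P_def)
    qed
    then have "P ?N" using bal(2) by (simp add: P_def)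
    moreover have "f N < f ?N"
      unfolding f_def
    proof (rule sum_strict_mono_ex1)
      show "\<forall>v\<in>?V. N v \<le> ?N v" using p by (auto simp: prime_gt_0_nat Suc_le_eq)
      show "\<exists>v\<in>?V. N v < ?N v"
        using e pos[of "org e"] prime_gt_1_nat[OF p] by (intro bexI[of _ "org e"]) auto
    qed simp
    ultimately show False using max[of ?N] by simp
  qed
  then show ?thesis using N unfolding P_def by blast
qed

end

context admissible_map
begin

text \<open>The projection of a plateau is a \<open>plateau_support\<close>, so no label at a vertex
  of \<open>P\<close> is divisible by \<open>p\<close>. Then \<open>P\<close> contains every arc at
  its vertices and, \<Delta> being connected, everything.\<close>

lemma no_proper_plateau:
  assumes conn: "connected (skeleton \<Delta>)"
    and N: "\<And>x. x \<in> VT \<Longrightarrow> vmult \<pi> x = N (vmap \<pi> x)"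
    and no_support: "\<And>p S e. prime p \<Longrightarrow> base.plateau_support N (int p) S \<Longrightarrow> e \<in> EB \<Longrightarrow> tlB e \<in> S \<Longrightarrow>
      \<not> int p dvd base.edge_label N e"
  shows "\<not> proper_plateau \<Delta> P"
proof
  assume "proper_plateau \<Delta> P"
  then obtain p where p: "prime p" "p_plateau \<Delta> p P" and proper: "P \<noteq> skeleton \<Delta>"
    by (auto simp: proper_plateau_def plateau_def)
  then have sub: "subgraph P (skeleton \<Delta>)" and opp: "opposite \<Delta> ` arcs P \<subseteq> arcs P"
    and P: "connected P"
    and dvd: "\<And>f. f \<in> ET \<Longrightarrow> tlT f \<in> verts P \<Longrightarrow> int p dvd label \<Delta> f \<longleftrightarrow> f \<notin> arcs P"
    by (auto simp: p_plateau_def)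
  have PV: "verts P \<subseteq> VT" and PE: "arcs P \<subseteq> ET" and ends: "tail P = tlT" "head P = hdT"
    using sub by (auto simp: subgraph_def Digraph_Component.compatible_def)
  have head_P: "hdT f \<in> verts P" if "f \<in> arcs P" for f
    using sub that ends wf_digraph.head_in_verts[of P f] by (auto simp: subgraph_def)
  \<comment> \<open>Multiplicities are constant on fibres, so the label of an arc of \<Delta>
    depends only on its image.\<close>
  have label: "label \<Delta> f = base.edge_label N (emap \<pi> f)" if "f \<in> ET" for f
  proof -
    have "label \<Delta> f * k (tlT f) (emap \<pi> f) = label \<Gamma> (emap \<pi> f)"
      using that by (intro admissible_lifts(3) lifts_at_self) auto
    moreover have "k (tlT f) (emap \<pi> f) = base.edge_gcd N (emap \<pi> f)"
      using that N by (simp add: k_def m_def base.edge_gcd_def)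
    moreover have "k (tlT f) (emap \<pi> f) > 0" using that by (simp add: k_pos)
    ultimately show ?thesis unfolding base.edge_label_def by (metis nonzero_mult_div_cancel_right less_irrefl)
  qed
  have "base.plateau_support N (int p) (vmap \<pi> ` verts P)"
    unfolding base.plateau_support_def
  proof (intro conjI ballI impI)
    show "vmap \<pi> ` verts P \<subseteq> VB" using PV by auto
  next
    fix e assume e: "e \<in> EB" "tlB e \<in> vmap \<pi> ` verts P" "\<not> int p dvd base.edge_label N e"
    then obtain x where x: "x \<in> verts P" "vmap \<pi> x = tlB e" by auto
    \<comment> \<open>The exponent 0 is arbitrary; any value yields a lift at
      \<open>x\<close>.\<close>
    obtain f where "f \<in> lifts_at x e"
      using lift_exists[of e x 0] e(1) x PV by blast
    then have f: "f \<in> ET" "tlT f = x" "emap \<pi> f = e" by (auto simp: lifts_def)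
    then have fP: "f \<in> arcs P" using dvd[of f] x e(3) label by auto
    then have hP: "hdT f \<in> verts P" by (rule head_P)
    then show "hdB e \<in> vmap \<pi> ` verts P" using f vmap_head[of f] by (metis imageI)
    have "opposite \<Delta> f \<in> arcs P" using fP opp by auto
    then show "\<not> int p dvd base.edge_label N (opposite \<Gamma> e)"
      using dvd[of "opposite \<Delta> f"] f hP label[of "opposite \<Delta> f"] by auto
  qed
  then have "\<not> int p dvd label \<Delta> f" if "f \<in> ET" "tlT f \<in> verts P" for f
    using no_support[OF p(1)] label that by (metis emap_in_arcs imageI vmap_tail)
  then have closed: "f \<in> arcs P" if "f \<in> ET" "tlT f \<in> verts P" for f
    using dvd that by blast
  have "verts P \<noteq> {}" using P by (auto simp: connected_def strongly_connected_def)
  then obtain x where x: "x \<in> verts P" by blast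
  have "y \<in> verts P" if "y \<in> VT" for y
  proof -
    have "x \<rightarrow>\<^sup>*\<^bsub>skeleton \<Delta>\<^esub> y"
      using total.symmetric_connected_imp_strongly_connected[OF total.sym_arcs conn] x PV that
      by (auto simp: strongly_connected_def)
    then show ?thesis
      by (induction rule: total.reachable_induct) (use x closed head_P in auto)
  qed
  then have "verts P = VT" using PV by blast
  moreover from this have "arcs P = ET" using PE closed by auto
  ultimately have "P = skeleton \<Delta>" using ends by simp
  with proper show False ..
qed

end

section \<open>Construction of the covering graph\<close>

text \<open>In a symmetric graph the strong components are the components. Reversal becomes the
  identity off the remaining arcs, as \<open>bidirected_digraph\<close> requires.\<close>

definition component :: "('v, 'e) lgraph \<Rightarrow> 'v \<Rightarrow> ('v, 'e) lgraph" where
  "component \<Gamma> v = (let H = skeleton \<Gamma> \<restriction> pre_digraph.scc_of (skeleton \<Gamma>) v in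
     \<lparr>skeleton = H, opposite = (\<lambda>e. if e \<in> arcs H then opposite \<Gamma> e else e), label = label \<Gamma>\<rparr>)"

context labelled_graph
begin

lemma component_closed:
  assumes "e \<in> arcs (skeleton \<Gamma>)"
  shows "head (skeleton \<Gamma>) e \<in> scc_of v \<longleftrightarrow> tail (skeleton \<Gamma>) e \<in> scc_of v"
proof -
  have "tail (skeleton \<Gamma>) e \<rightarrow>\<^bsub>skeleton \<Gamma>\<^esub> head (skeleton \<Gamma>) e"
    using assms by (auto simp: arcs_ends_conv)
  then have "tail (skeleton \<Gamma>) e \<rightarrow>\<^sup>*\<^bsub>skeleton \<Gamma>\<^esub> head (skeleton \<Gamma>) e"
    "head (skeleton \<Gamma>) e \<rightarrow>\<^sup>*\<^bsub>skeleton \<Gamma>\<^esub> tail (skeleton \<Gamma>) e"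
    using graph_symmetric by auto
  then show ?thesis by (auto simp: scc_of_def intro: reachable_trans)
qed

lemma component_simps:
  shows "verts (skeleton (component \<Gamma> v)) = scc_of v"
    and "arcs (skeleton (component \<Gamma> v)) = {e \<in> arcs (skeleton \<Gamma>). tail (skeleton \<Gamma>) e \<in> scc_of v}"
    and "tail (skeleton (component \<Gamma> v)) = tail (skeleton \<Gamma>)"
    and "head (skeleton (component \<Gamma> v)) = head (skeleton \<Gamma>)"
    and "label (component \<Gamma> v) = label \<Gamma>"
    and "e \<in> arcs (skeleton (component \<Gamma> v)) \<Longrightarrow> opposite (component \<Gamma> v) e = opposite \<Gamma> e"
    and "e \<notin> arcs (skeleton (component \<Gamma> v)) \<Longrightarrow> opposite (component \<Gamma> v) e = e"
  using component_closed by (auto simp: component_def Let_def)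

lemma scc_of_subset: "scc_of v \<subseteq> verts (skeleton \<Gamma>)"
  by (auto simp: scc_of_def reachable_in_verts)

lemma connected_labelled_graph_component:
  assumes v: "v \<in> verts (skeleton \<Gamma>)"
  shows "connected_labelled_graph (component \<Gamma> v)"
proof -
  interpret fin_digraph "skeleton \<Gamma>" by (rule fin)
  let ?H = "skeleton (component \<Gamma> v)"
  have H: "?H = skeleton \<Gamma> \<restriction> scc_of v" by (simp add: component_def Let_def)
  interpret H: wf_digraph ?H unfolding H by (rule wellformed_induce_subgraph)
  have "fin_digraph ?H"
    by unfold_locales
      (auto simp: component_simps(1,2) intro: finite_subset[OF scc_of_subset finite_verts])
  moreover have "bidirected_digraph ?H (opposite (component \<Gamma> v))"
  proof (rule H.bidirected_digraphI)
    fix e assume "e \<in> arcs ?H"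
    moreover from this have "opposite \<Gamma> e \<in> arcs ?H"
      by (auto simp: component_simps(2) component_closed)
    ultimately show "opposite (component \<Gamma> v) e \<noteq> e"
      "opposite (component \<Gamma> v) (opposite (component \<Gamma> v) e) = e"
      "tail ?H (opposite (component \<Gamma> v) e) = head ?H e"
      using arev_neq by (auto simp: component_simps)
  qed (simp add: component_simps)
  moreover have "label (component \<Gamma> v) e \<noteq> 0" if "e \<in> arcs ?H" for e
    using that label_nonzero by (simp add: component_simps)
  ultimately have "labelled_graph (component \<Gamma> v)" by (rule labelled_graph.intro)
  moreover have "strongly_connected ?H"
    using scc_of_in_sccs_verts[OF v] unfolding in_sccs_verts_conv H by (auto elim: in_sccsE)
  then have "connected ?H"
    using H.reachable_mk_symmetricI unfolding connected_def strongly_connected_def by auto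
  ultimately show ?thesis by (simp add: connected_labelled_graph_def)
qed

end

text \<open>A component contains all arcs at its vertices, so the sets of lifts there, and with them
  the local conditions, do not change.\<close>

lemma (in admissible_map) admissible_component:
  "admissible (component \<Delta> x) \<Gamma> \<pi>"
proof -
  let ?D = "component \<Delta> x"
  note simps = total.component_simps[where v = x]
  have sub: "verts (skeleton ?D) \<subseteq> VT" "arcs (skeleton ?D) \<subseteq> ET"
    using total.scc_of_subset by (auto simp: simps)
  have "lifts ?D (emap \<pi>) y e = lifts_at y e" if "y \<in> verts (skeleton ?D)" for y e
    using that by (auto simp: lifts_def simps(1-3))
  moreover have "graph_morphism ?D \<Gamma> (vmap \<pi>) (emap \<pi>)"
    using sub admissible unfolding admissible_def graph_morphism_def
    by (auto simp: simps(3,6) subset_iff)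
  ultimately show ?thesis
    using sub admissible unfolding admissible_def
    by (simp add: simps(5,6) subset_iff)
qed

text \<open>Arc copies numbered below \<open>c * k\<close> and attached to the vertex copy given by
  their index modulo \<open>c\<close> are spread evenly; with \<open>k\<close> the gcd, each vertex
  copy gets the number of lifts that admissibility prescribes.\<close>

lemma card_residue_class:
  fixes c k j :: nat
  assumes "j < c"
  shows "card {i. i < c * k \<and> i mod c = j} = k"
proof -
  have "{i. i < c * k \<and> i mod c = j} = (\<lambda>t. c * t + j) ` {..<k}"
  proof (intro equalityI subsetI)
    fix i assume i: "i \<in> {i. i < c * k \<and> i mod c = j}"
    then have "i = c * (i div c) + j" by auto
    moreover have "i div c < k" using i assms by (simp add: less_mult_imp_div_less mult.commute)
    ultimately show "i \<in> (\<lambda>t. c * t + j) ` {..<k}" by blast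
  next
    fix i assume "i \<in> (\<lambda>t. c * t + j) ` {..<k}"
    then obtain t where t: "t < k" "i = c * t + j" by auto
    have "c * t + j < c * Suc t" using assms by simp
    also have "\<dots> \<le> c * k" using t(1) by (intro mult_le_mono2) simp
    finally show "i \<in> {i. i < c * k \<and> i mod c = j}" using t(2) assms by simp
  qed
  moreover have "inj_on (\<lambda>t. c * t + j) {..<k}" using assms by (auto intro!: inj_onI)
  ultimately show ?thesis by (simp add: card_image)
qed

text \<open>
  All vertices over \<open>v\<close> get multiplicity \<open>N v\<close>. As \<open>N v\<close> times the number of vertices over \<open>v\<close> does not
  depend on \<open>v\<close>, both orientations of an edge have the same total number of lifts, and the lifts
  can be matched arbitrarily.
\<close>

locale balanced_graph = labelled_graph \<Gamma> for \<Gamma> :: "('v, 'e) lgraph" +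
  fixes N :: "'v \<Rightarrow> nat"
  assumes balanced: "balanced N"
begin

text \<open>A common multiple of all \<open>N v\<close>, so that the quotient defining
  \<open>vert_copies\<close> is exact.\<close>

definition total_size :: nat where "total_size = (\<Prod>v \<in> verts (skeleton \<Gamma>). N v)"

definition vert_copies :: "'v \<Rightarrow> nat" where "vert_copies v = total_size div N v"

definition arc_copies :: "'e \<Rightarrow> nat" where "arc_copies e = vert_copies (org e) * nat (edge_gcd N e)"

definition cover_verts :: "('v \<times> nat) set" where
  "cover_verts = (SIGMA v : verts (skeleton \<Gamma>). {..<vert_copies v})"

definition cover_arcs :: "('e \<times> nat) set" where
  "cover_arcs = (SIGMA e : arcs (skeleton \<Gamma>). {..<arc_copies e})"

text \<open>Numbering the finitely many vertices and arcs yields a graph of type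
  \<open>(nat, nat) lgraph\<close>.\<close>

abbreviation enc_vert :: "'v \<times> nat \<Rightarrow> nat" where "enc_vert \<equiv> to_nat_on cover_verts"
abbreviation dec_vert :: "nat \<Rightarrow> 'v \<times> nat" where "dec_vert \<equiv> from_nat_into cover_verts"
abbreviation enc_arc :: "'e \<times> nat \<Rightarrow> nat" where "enc_arc \<equiv> to_nat_on cover_arcs"
abbreviation dec_arc :: "nat \<Rightarrow> 'e \<times> nat" where "dec_arc \<equiv> from_nat_into cover_arcs"

definition cover_tail :: "'e \<times> nat \<Rightarrow> 'v \<times> nat" where
  "cover_tail a = (org (fst a), snd a mod vert_copies (org (fst a)))"

definition cover_opp :: "'e \<times> nat \<Rightarrow> 'e \<times> nat" where
  "cover_opp a = (opposite \<Gamma> (fst a), snd a)"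

definition cover :: "(nat, nat) lgraph" where
  "cover = \<lparr>skeleton = \<lparr>verts = enc_vert ` cover_verts, arcs = enc_arc ` cover_arcs,
       tail = (\<lambda>f. enc_vert (cover_tail (dec_arc f))),
       head = (\<lambda>f. enc_vert (cover_tail (cover_opp (dec_arc f))))\<rparr>,
     opposite = (\<lambda>f. if f \<in> enc_arc ` cover_arcs then enc_arc (cover_opp (dec_arc f)) else f),
     label = (\<lambda>f. edge_label N (fst (dec_arc f)))\<rparr>"

definition cover_map :: "(nat, nat, 'v, 'e) map_with_mult" where
  "cover_map = \<lparr>vmap = (\<lambda>x. fst (dec_vert x)), emap = (\<lambda>f. fst (dec_arc f)),
     vmult = (\<lambda>x. N (fst (dec_vert x))), emult = (\<lambda>f. nat (edge_mult N (fst (dec_arc f))))\<rparr>"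

interpretation fin_digraph "skeleton \<Gamma>" by (rule fin)

lemma N_pos: "v \<in> verts (skeleton \<Gamma>) \<Longrightarrow> N v > 0"
  using balanced by (simp add: balanced_def)

lemma vert_copies: "v \<in> verts (skeleton \<Gamma>) \<Longrightarrow> vert_copies v * N v = total_size"
  by (simp add: vert_copies_def total_size_def dvd_prodI)

lemma vert_copies_pos:
  assumes "v \<in> verts (skeleton \<Gamma>)"
  shows "vert_copies v > 0"
proof -
  have "total_size > 0" using N_pos by (simp add: total_size_def)
  then show ?thesis using vert_copies[OF assms] by (metis mult_is_0 neq0_conv)
qed

lemma edge_mult_pos:
  assumes "e \<in> arcs (skeleton \<Gamma>)"
  shows "edge_mult N e > 0"
proof -
  have "edge_mult N e * edge_gcd N e > 0" using N_pos assms by (simp add: edge_mult_gcd)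
  then show ?thesis using edge_gcd_pos[OF balanced assms] by (simp add: zero_less_mult_iff)
qed

text \<open>The total is the same for all arcs, so arcs of equal multiplicity, in particular
  \<open>e\<close> and its opposite, have equally many copies.\<close>

lemma arc_copies_mult:
  assumes e: "e \<in> arcs (skeleton \<Gamma>)"
  shows "int (arc_copies e) * edge_mult N e = int total_size"
proof -
  have "int (arc_copies e) * edge_mult N e = int (vert_copies (org e)) * (edge_mult N e * edge_gcd N e)"
    using edge_gcd_pos[OF balanced e] by (simp add: arc_copies_def)
  also have "\<dots> = int (vert_copies (org e) * N (org e))" by (simp add: edge_mult_gcd)
  finally show ?thesis using vert_copies e by simp
qed

lemma arc_copies_opposite:
  assumes e: "e \<in> arcs (skeleton \<Gamma>)"
  shows "arc_copies (opposite \<Gamma> e) = arc_copies e"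
proof -
  have "edge_mult N (opposite \<Gamma> e) = edge_mult N e" using balanced e by (simp add: balanced_def)
  then have "int (arc_copies (opposite \<Gamma> e)) * edge_mult N e = int (arc_copies e) * edge_mult N e"
    using arc_copies_mult[OF e] arc_copies_mult[of "opposite \<Gamma> e"] e by simp
  then show ?thesis using edge_mult_pos[OF e] by simp
qed

lemma finite_cover: "finite cover_verts" "finite cover_arcs"
  by (simp_all add: cover_verts_def cover_arcs_def)

lemma dec_enc [simp]:
  "a \<in> cover_verts \<Longrightarrow> dec_vert (enc_vert a) = a" "b \<in> cover_arcs \<Longrightarrow> dec_arc (enc_arc b) = b"
  using finite_cover by (simp_all add: countable_finite)

lemma enc_vert_eq_iff [simp]:
  "a \<in> cover_verts \<Longrightarrow> b \<in> cover_verts \<Longrightarrow> enc_vert a = enc_vert b \<longleftrightarrow> a = b"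
  by (metis dec_enc(1))

lemma enc_arc_eq_iff [simp]:
  "a \<in> cover_arcs \<Longrightarrow> b \<in> cover_arcs \<Longrightarrow> enc_arc a = enc_arc b \<longleftrightarrow> a = b"
  by (metis dec_enc(2))

lemma cover_tail_in_verts [simp]: "a \<in> cover_arcs \<Longrightarrow> cover_tail a \<in> cover_verts"
  using vert_copies_pos by (auto simp: cover_tail_def cover_verts_def cover_arcs_def)

lemma cover_opp_in_arcs [simp]: "a \<in> cover_arcs \<Longrightarrow> cover_opp a \<in> cover_arcs"
  using arc_copies_opposite by (auto simp: cover_opp_def cover_arcs_def)

lemma cover_opp_opp [simp]: "cover_opp (cover_opp a) = a"
  by (simp add: cover_opp_def)

lemma Pair_cover_arcs: "(e, i) \<in> cover_arcs \<Longrightarrow> e \<in> arcs (skeleton \<Gamma>)"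
  by (simp add: cover_arcs_def)

lemma fst_cover_arcs: "a \<in> cover_arcs \<Longrightarrow> fst a \<in> arcs (skeleton \<Gamma>)"
  by (cases a) (simp add: Pair_cover_arcs)

lemma Pair_cover_verts: "(v, i) \<in> cover_verts \<Longrightarrow> v \<in> verts (skeleton \<Gamma>)"
  by (simp add: cover_verts_def)

lemma labelled_graph_cover: "labelled_graph cover"
proof (rule labelled_graph.intro)
  interpret cov: wf_digraph "skeleton cover"
    by unfold_locales (auto simp: cover_def)
  show "fin_digraph (skeleton cover)"
    by unfold_locales (simp_all add: cover_def finite_cover)
  show "bidirected_digraph (skeleton cover) (opposite cover)"
  proof (rule cov.bidirected_digraphI)
    fix f assume "f \<in> arcs (skeleton cover)"
    then obtain a where a: "a \<in> cover_arcs" "f = enc_arc a" by (auto simp: cover_def)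
    have "cover_opp a \<noteq> a"
      using arev_neq[OF fst_cover_arcs[OF a(1)]] by (auto simp: cover_opp_def prod_eq_iff)
    then show "opposite cover f \<noteq> f"
      using a by (auto simp: cover_def)
    show "opposite cover (opposite cover f) = f"
      "tail (skeleton cover) (opposite cover f) = head (skeleton cover) f"
      using a by (auto simp: cover_def)
  qed (simp add: cover_def)
  show "label cover f \<noteq> 0" if "f \<in> arcs (skeleton cover)" for f
  proof -
    from that have "f \<in> enc_arc ` cover_arcs" by (simp add: cover_def)
    then obtain a where a: "a \<in> cover_arcs" "f = enc_arc a" by blast
    then have "label cover f * edge_gcd N (fst a) = label \<Gamma> (fst a)"
      by (simp add: cover_def edge_label_gcd)
    then show ?thesis
      using label_nonzero[OF fst_cover_arcs[OF a(1)]] by (intro notI) simp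
  qed
qed

lemma admissible_cover: "admissible cover \<Gamma> cover_map"
proof -
  have morphism: "graph_morphism cover \<Gamma> (vmap cover_map) (emap cover_map)"
    by (auto simp: graph_morphism_def cover_def cover_map_def dest: Pair_cover_verts Pair_cover_arcs)
      (simp_all add: cover_tail_def cover_opp_def)
  have emult: "emult cover_map f > 0 \<and> emult cover_map (opposite cover f) = emult cover_map f"
    if "f \<in> arcs (skeleton cover)" for f
  proof -
    from that have "f \<in> enc_arc ` cover_arcs" by (simp add: cover_def)
    then obtain a where a: "a \<in> cover_arcs" "f = enc_arc a" by blast
    have "fst a \<in> arcs (skeleton \<Gamma>)" using a(1) by (rule fst_cover_arcs)
    moreover have "fst (cover_opp a) = opposite \<Gamma> (fst a)" by (simp add: cover_opp_def)
    ultimately show ?thesis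
      using a edge_mult_pos[of "fst a"] balanced
      by (auto simp: cover_def cover_map_def balanced_def)
  qed
  have lifts: "int (card (lifts cover (emap cover_map) x e)) = edge_gcd N e"
    if e: "e \<in> arcs (skeleton \<Gamma>)" and x: "x \<in> verts (skeleton cover)"
      and xe: "vmap cover_map x = org e" for x e
  proof -
    obtain j where j: "(org e, j) \<in> cover_verts" "x = enc_vert (org e, j)"
      using x xe by (auto simp: cover_def cover_map_def)
    have eq: "lifts cover (emap cover_map) x e =
        enc_arc ` (\<lambda>i. (e, i)) ` {i. i < arc_copies e \<and> i mod vert_copies (org e) = j}"
    proof (intro equalityI subsetI)
      fix f assume "f \<in> lifts cover (emap cover_map) x e"
      then obtain a where a: "a \<in> cover_arcs" "f = enc_arc a" "enc_vert (cover_tail a) = x" "fst a = e"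
        by (auto simp: lifts_def cover_def cover_map_def)
      then have "cover_tail a = (org e, j)" using j by auto
      then show "f \<in> enc_arc ` (\<lambda>i. (e, i)) ` {i. i < arc_copies e \<and> i mod vert_copies (org e) = j}"
        using a by (cases a) (auto simp: cover_tail_def cover_arcs_def)
    next
      fix f assume "f \<in> enc_arc ` (\<lambda>i. (e, i)) ` {i. i < arc_copies e \<and> i mod vert_copies (org e) = j}"
      then obtain i where i: "f = enc_arc (e, i)" "i < arc_copies e" "i mod vert_copies (org e) = j" by auto
      then have "(e, i) \<in> cover_arcs" using e by (simp add: cover_arcs_def)
      then show "f \<in> lifts cover (emap cover_map) x e"
        using i j by (auto simp: lifts_def cover_def cover_map_def cover_tail_def)
    qed
    have inj: "inj_on enc_arc ((\<lambda>i. (e, i)) ` {i. i < arc_copies e \<and> i mod vert_copies (org e) = j})"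
      using e finite_cover(2)
      by (intro inj_on_subset[OF inj_on_to_nat_on]) (auto simp: cover_arcs_def countable_finite)
    have "card (lifts cover (emap cover_map) x e) =
        card ((\<lambda>i. (e, i)) ` {i. i < arc_copies e \<and> i mod vert_copies (org e) = j})"
      unfolding eq using inj by (rule card_image)
    also have "\<dots> = card {i. i < arc_copies e \<and> i mod vert_copies (org e) = j}"
      by (rule card_image) (simp add: inj_on_def)
    also have "\<dots> = nat (edge_gcd N e)"
      unfolding arc_copies_def using j(1) by (intro card_residue_class) (simp add: cover_verts_def)
    finally show ?thesis using edge_gcd_pos[OF balanced e] by simp
  qed
  have "int (emult cover_map f) = edge_mult N e \<and> label cover f = edge_label N e"
    if "e \<in> arcs (skeleton \<Gamma>)" "f \<in> lifts cover (emap cover_map) x e" for x e f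
    using that edge_mult_pos[of e] by (auto simp: lifts_def cover_def cover_map_def)
  moreover have "vmult cover_map x = N (vmap cover_map x)" for x by (simp add: cover_map_def)
  moreover have "vmult cover_map x > 0" if "x \<in> verts (skeleton cover)" for x
  proof -
    from that have "x \<in> enc_vert ` cover_verts" by (simp add: cover_def)
    then obtain v i where "(v, i) \<in> cover_verts" "x = enc_vert (v, i)" by auto
    then show ?thesis using N_pos[OF Pair_cover_verts] by (simp add: cover_map_def)
  qed
  ultimately show ?thesis
    unfolding admissible_def Let_def using morphism emult lifts
    by (auto simp: edge_mult_def edge_label_def edge_gcd_def)
qed

end

text \<open>The vertex over a prescribed \<open>v\<close> is kept because a group represented by
  \<Gamma> comes with a base vertex, over which the subgroup has to be based.\<close>

theorem exists_admissible_without_plateau: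
  fixes \<Gamma> :: "('v, 'e) lgraph"
  assumes \<Gamma>: "connected_labelled_graph \<Gamma>" and v: "v \<in> verts (skeleton \<Gamma>)"
  shows "\<exists>(\<Delta> :: (nat, nat) lgraph) \<pi> x. connected_labelled_graph \<Delta> \<and> admissible \<Delta> \<Gamma> \<pi> \<and>
    (\<nexists>P. proper_plateau \<Delta> P) \<and> x \<in> verts (skeleton \<Delta>) \<and> vmap \<pi> x = v"
proof -
  interpret labelled_graph \<Gamma> using \<Gamma> by (simp add: connected_labelled_graph_def)
  obtain N where N: "balanced N"
    and no_support: "\<And>p S e. prime p \<Longrightarrow> plateau_support N (int p) S \<Longrightarrow> e \<in> arcs (skeleton \<Gamma>) \<Longrightarrow>
      org e \<in> S \<Longrightarrow> \<not> int p dvd edge_label N e"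
    using exists_balanced_without_plateau \<Gamma> unfolding connected_labelled_graph_def by blast
  interpret balanced_graph \<Gamma> N by unfold_locales (rule N)
  interpret cov: admissible_map \<Gamma> cover cover_map
    using labelled_graph_cover admissible_cover labelled_graph_axioms
    by (intro admissible_map.intro admissible_map_axioms.intro)
  \<comment> \<open>Copy 0 exists since \<open>vert_copies v\<close> is positive; taking the
    component of this vertex ensures that it meets the fibre over \<open>v\<close>.\<close>
  define x where "x = enc_vert (v, 0)"
  have "(v, 0) \<in> cover_verts" using v vert_copies_pos by (simp add: cover_verts_def)
  then have x: "x \<in> verts (skeleton cover)" "vmap cover_map x = v"
    by (auto simp: x_def cover_def cover_map_def)
  let ?D = "component cover x"
  have D: "connected_labelled_graph ?D" by (rule cov.total.connected_labelled_graph_component[OF x(1)])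
  interpret comp: admissible_map \<Gamma> ?D cover_map
    using D cov.admissible_component labelled_graph_axioms
    by (intro admissible_map.intro admissible_map_axioms.intro) (simp_all add: connected_labelled_graph_def)
  have "\<not> proper_plateau ?D P" for P
    by (rule comp.no_proper_plateau[where N = N])
      (use D no_support in \<open>auto simp: connected_labelled_graph_def cover_map_def\<close>)
  moreover have "x \<in> verts (skeleton ?D)"
    using x(1) cov.total.in_scc_of_self by (simp add: cov.total.component_simps)
  ultimately show ?thesis using D comp.admissible x(2) by blast
qed

theorem proposition6p8:
  shows "(\<forall>\<Gamma> :: ('v, 'e) lgraph. connected_labelled_graph \<Gamma> \<longrightarrow>
            (\<exists>(\<Delta> :: (nat, nat) lgraph) \<pi>.
               connected_labelled_graph \<Delta> \<and> admissible \<Delta> \<Gamma> \<pi> \<and>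
               (\<nexists>P. proper_plateau \<Delta> P))) \<and>
         (\<forall>A :: 'g monoid. GBS_group A \<longrightarrow>
            (\<exists>H (\<Delta> :: (nat, nat) lgraph).
               subgroup H A \<and> finite (rcosets\<^bsub>A\<^esub> H) \<and>
               represented_by (A\<lparr>carrier := H\<rparr>) \<Delta> \<and>
               (\<nexists>P. proper_plateau \<Delta> P)))"
proof (intro conjI allI impI)
  fix \<Gamma> :: "('v, 'e) lgraph" assume \<Gamma>: "connected_labelled_graph \<Gamma>"
  then have "verts (skeleton \<Gamma>) \<noteq> {}"
    by (simp add: connected_labelled_graph_def connected_def strongly_connected_def)
  then obtain v where "v \<in> verts (skeleton \<Gamma>)" by blast
  then show "\<exists>(\<Delta> :: (nat, nat) lgraph) \<pi>. connected_labelled_graph \<Delta> \<and> admissible \<Delta> \<Gamma> \<pi> \<and>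
      (\<nexists>P. proper_plateau \<Delta> P)"
    using exists_admissible_without_plateau[OF \<Gamma>] by metis
next
  fix A :: "'g monoid" assume "GBS_group A"
  then obtain \<Gamma> :: "(nat, nat) lgraph" and v where A: "group A" and \<Gamma>: "connected_labelled_graph \<Gamma>"
    and v: "v \<in> verts (skeleton \<Gamma>)" "A \<cong> labelled_graph_group \<Gamma> v"
    by (auto simp: GBS_group_def represented_by_def)
  obtain \<Delta> :: "(nat, nat) lgraph" and \<pi> x where \<Delta>: "connected_labelled_graph \<Delta>" "admissible \<Delta> \<Gamma> \<pi>"
    "\<nexists>P. proper_plateau \<Delta> P" "x \<in> verts (skeleton \<Delta>)" "vmap \<pi> x = v"
    using exists_admissible_without_plateau[OF \<Gamma> v(1)] by metis
  show "\<exists>H (\<Delta> :: (nat, nat) lgraph). subgroup H A \<and> finite (rcosets\<^bsub>A\<^esub> H) \<and>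
      represented_by (A\<lparr>carrier := H\<rparr>) \<Delta> \<and> (\<nexists>P. proper_plateau \<Delta> P)"
    using admissible_map_finite_index[OF A _ \<Gamma> \<Delta>(1,2,4)] v(2) \<Delta>(3,5) by metis
qed

end
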